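(* Let $A$ be a finite abelian group, let $n\geqslant 2$, let $w_T=\sum_{1\leqslant i<j\leqslant n}\mathsf a_{ij}(ij)$ with $\mathsf a_{ij}\geqslant 0$ and $w_N=\sum_{x\in A^n}\mathsf c_x\,x$ with $\mathsf c_x=\mathsf c_{x^{-1}}\geqslant 0$, and let $\kappa$ be a multiplicity vector. Realise $V_\kappa$ on $\mathbb C[\Omega_\kappa]$, with basis $\{\mathbf e_z\}_{z\in\Omega_\kappa}$ and action $x\cdot\mathbf e_z=\langle z,x\rangle\mathbf e_z$ $(x\in A^n)$, $\pi\cdot\mathbf e_z=\mathbf e_{\pi\cdot z}$ $(\pi\in\mathfrak S_n)$, a function $f$ on $\Omega_\kappa$ corresponding to $\sum_z f(z)\mathbf e_z$. Then in this realisation $$V_\kappa\bigl(\Delta_{A\wr\mathfrak S_n}(w_T+w_N)\bigr)=\mathcal L_\kappa,$$ where $\mathcal L_\kappa$ is the operator on $\mathbb C[\Omega_\kappa]$ given by $$(\mathcal L_\kappa f)(z)=\sum_{1\leqslant i<j\leqslant n}\mathsf a_{ij}\bigl(f(z)-f((ij)\cdot z)\bigr)+Q(z)f(z),\qquad Q(z)=\sum_{x\in A^n}\mathsf c_x\bigl(1-\operatorname{Re}\langle z,x\rangle\bigr).$$ If $V_\kappa$ is non-trivial, then $\psi_{A\wr\mathfrak S_n}(w_T+w_N,V_\kappa)=\lambda_{\min}(\mathcal L_\kappa)$.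
   Context: $A\wr\mathfrak S_n=A^n\rtimes\mathfrak S_n$ with multiplication $(g;\pi)(h;\sigma)=(g(\pi\cdot h);\pi\sigma)$, $\pi\cdot g=(g_{\pi^{-1}(1)},\dots,g_{\pi^{-1}(n)})$; $A^n$ and $\mathfrak S_n$ are regarded as subgroups, and $(ij)$ is the transposition. For a finite group $H$ and $w=\sum_h\mathsf c_h h\in\mathbb R[H]$ with $\mathsf c_h=\mathsf c_{h^{-1}}\geqslant 0$, put $\Delta_H(w)=\sum_h\mathsf c_h(1_H-h)$; $V(\Delta_H(w))$ is the operator by which it acts in a finite-dimensional complex unitary representation $V$. $\psi_H(w,V)$ is the smallest eigenvalue of $V(\Delta_H(w))$ on $(V^H)^\perp$, where $V^H$ is the fixed subspace (and $+\infty$ if $V=V^H$). $\lambda_{\min}$ denotes the least eigenvalue. $\widehat A$ is the character group of $A$. A multiplicity vector is a family $\kappa=(\kappa_\chi)_{\chi\in\widehat A}$ of non-negative integers with $\sum_\chi\kappa_\chi=n$. $V_\kappa$ is the irreducible representation of $A\wr\mathfrak S_n$ indexed by the multipartition whose $\chi$-component is the one-row partition $(\kappa_\chi)$, that is, $V_\kappa=\mathrm{Ind}_{\prod_\chi(A\wr\mathfrak S_{\kappa_\chi})}^{A\wr\mathfrak S_n}(\boxtimes_\chi\chi^{\otimes\kappa_\chi})$, where on $\chi^{\otimes m}$ the group $A^m$ acts by $(g_1,\dots,g_m)\mapsto\prod_i\chi(g_i)$ and $\mathfrak S_m$ acts trivially; it is isomorphic to the representation on $\mathbb C[\Omega_\kappa]$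 described in the claim. $\Omega_\kappa=\{z=(\chi_1,\dots,\chi_n)\in\widehat A^n:\ |\{i:\chi_i=\chi\}|=\kappa_\chi\ \forall\chi\in\widehat A\}$, with $\mathfrak S_n$ permuting coordinates, $\pi\cdot z=(\chi_{\pi^{-1}(1)},\dots,\chi_{\pi^{-1}(n)})$; the $\mathbf e_z$ form an orthonormal basis of $\mathbb C[\Omega_\kappa]$. For $z=(\chi_1,\dots,\chi_n)\in\widehat A^n$ and $x=(x_1,\dots,x_n)\in A^n$, $\langle z,x\rangle=\prod_{i=1}^n\chi_i(x_i)$. *)

theory Defs
  imports
    Complex_Main
    "HOL-Algebra.Sym_Groups"
    "HOL-Algebra.Product_Groups"
    "HOL-Library.Extended_Real"
    "HOL-Library.Function_Algebras"
begin

section \<open>Finite-dimensional complex unitary representations\<close>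

text \<open>
  A representation space is a linear subspace \<open>rep_space\<close> of an ambient type that carries a complex
  scalar multiplication \<open>rep_scale\<close>. The inner product is linear in its first argument.
\<close>

record ('g, 'v) urep =
  rep_space :: "'v set"
  rep_scale :: "complex \<Rightarrow> 'v \<Rightarrow> 'v"
  rep_inner :: "'v \<Rightarrow> 'v \<Rightarrow> complex"
  rep_act :: "'g \<Rightarrow> 'v \<Rightarrow> 'v"

locale unitary_rep = group G
  for G :: "('g, 'b) monoid_scheme" (structure)
    and R :: "('g, 'v::ab_group_add) urep" +
  assumes vector_space: "vector_space (rep_scale R)"
    and subspace: "Modules.module.subspace (rep_scale R) (rep_space R)"
    and finite_dim:
      "\<exists>S. finite S \<and> S \<subseteq> rep_space R \<and> Modules.module.span (rep_scale R) S = rep_space R"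
    and inner_add: "\<lbrakk>u \<in> rep_space R; v \<in> rep_space R; w \<in> rep_space R\<rbrakk> \<Longrightarrow>
      rep_inner R (u + v) w = rep_inner R u w + rep_inner R v w"
    and inner_scale: "\<lbrakk>u \<in> rep_space R; v \<in> rep_space R\<rbrakk> \<Longrightarrow>
      rep_inner R (rep_scale R c u) v = c * rep_inner R u v"
    and inner_cnj: "\<lbrakk>u \<in> rep_space R; v \<in> rep_space R\<rbrakk> \<Longrightarrow>
      rep_inner R v u = cnj (rep_inner R u v)"
    and inner_pos: "\<lbrakk>u \<in> rep_space R; u \<noteq> 0\<rbrakk> \<Longrightarrow> 0 < Re (rep_inner R u u)"
    and act_closed: "\<lbrakk>g \<in> carrier G; u \<in> rep_space R\<rbrakk> \<Longrightarrow> rep_act R g u \<in> rep_space R"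
    and act_add: "\<lbrakk>g \<in> carrier G; u \<in> rep_space R; v \<in> rep_space R\<rbrakk> \<Longrightarrow>
      rep_act R g (u + v) = rep_act R g u + rep_act R g v"
    and act_scale: "\<lbrakk>g \<in> carrier G; u \<in> rep_space R\<rbrakk> \<Longrightarrow>
      rep_act R g (rep_scale R c u) = rep_scale R c (rep_act R g u)"
    and act_one: "u \<in> rep_space R \<Longrightarrow> rep_act R \<one> u = u"
    and act_mult: "\<lbrakk>g \<in> carrier G; h \<in> carrier G; u \<in> rep_space R\<rbrakk> \<Longrightarrow>
      rep_act R (g \<otimes> h) u = rep_act R g (rep_act R h u)"
    and act_unitary: "\<lbrakk>g \<in> carrier G; u \<in> rep_space R; v \<in> rep_space R\<rbrakk> \<Longrightarrow>
      rep_inner R (rep_act R g u) (rep_act R g v) = rep_inner R u v"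

definition rep_iso ::
    "('g, 'b) monoid_scheme \<Rightarrow> ('g, 'v::ab_group_add) urep \<Rightarrow> ('g, 'w::ab_group_add) urep \<Rightarrow> bool"
  where "rep_iso G R S \<longleftrightarrow> (\<exists>T. bij_betw T (rep_space R) (rep_space S) \<and>
    (\<forall>u\<in>rep_space R. \<forall>v\<in>rep_space R. T (u + v) = T u + T v) \<and>
    (\<forall>c. \<forall>u\<in>rep_space R. T (rep_scale R c u) = rep_scale S c (T u)) \<and>
    (\<forall>g\<in>carrier G. \<forall>u\<in>rep_space R. T (rep_act R g u) = rep_act S g (T u)))"

definition fixed_space :: "('g, 'b) monoid_scheme \<Rightarrow> ('g, 'v) urep \<Rightarrow> 'v set"
  where "fixed_space G R = {v \<in> rep_space R. \<forall>g\<in>carrier G. rep_act R g v = v}"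

definition orth_compl :: "('g, 'v) urep \<Rightarrow> 'v set \<Rightarrow> 'v set"
  where "orth_compl R U = {v \<in> rep_space R. \<forall>u\<in>U. rep_inner R u v = 0}"

definition nontrivial_rep :: "('g, 'b) monoid_scheme \<Rightarrow> ('g, 'v) urep \<Rightarrow> bool"
  where "nontrivial_rep G R \<longleftrightarrow> (\<exists>g\<in>carrier G. \<exists>v\<in>rep_space R. rep_act R g v \<noteq> v)"

text \<open>Restricting to real eigenvalues is harmless, as the operators concerned are Hermitian.\<close>

definition least_eigenvalue ::
    "(complex \<Rightarrow> 'v::zero \<Rightarrow> 'v) \<Rightarrow> 'v set \<Rightarrow> ('v \<Rightarrow> 'v) \<Rightarrow> real"
  where "least_eigenvalue sc W T =
    Min {l. \<exists>v\<in>W. v \<noteq> 0 \<and> T v = sc (complex_of_real l) v}"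

section \<open>The real group algebra and the spectral gap\<close>

text \<open>An element of the group algebra of a finite group is its coefficient function.\<close>

definition galg_of :: "'g \<Rightarrow> 'g \<Rightarrow> real"
  where "galg_of h = (\<lambda>g. of_bool (g = h))"

definition galg_lap :: "('g, 'b) monoid_scheme \<Rightarrow> ('g \<Rightarrow> real) \<Rightarrow> 'g \<Rightarrow> real"
  where "galg_lap G w =
    (\<lambda>g. \<Sum>h\<in>carrier G. w h * (galg_of \<one>\<^bsub>G\<^esub> g - galg_of h g))"

definition galg_act ::
    "('g, 'b) monoid_scheme \<Rightarrow> ('g, 'v::ab_group_add) urep \<Rightarrow> ('g \<Rightarrow> real) \<Rightarrow> 'v \<Rightarrow> 'v"
  where "galg_act G R w v =
    (\<Sum>g\<in>carrier G. rep_scale R (complex_of_real (w g)) (rep_act R g v))"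

definition psi ::
    "('g, 'b) monoid_scheme \<Rightarrow> ('g \<Rightarrow> real) \<Rightarrow> ('g, 'v::ab_group_add) urep \<Rightarrow> ereal"
  where "psi G w R =
    (if fixed_space G R = rep_space R then \<infinity>
     else ereal (least_eigenvalue (rep_scale R) (orth_compl R (fixed_space G R))
       (galg_act G R (galg_lap G w))))"

section \<open>Induced representations\<close>

text \<open>
  The induced representation consists of the \<open>H\<close>-equivariant functions on \<open>G\<close> (extended by \<open>0\<close>
  outside the carrier), on which \<open>G\<close> acts by right translation.
\<close>

definition induced_rep ::
    "('g, 'b) monoid_scheme \<Rightarrow> 'g set \<Rightarrow> ('g, 'v::ab_group_add) urep \<Rightarrow> ('g, 'g \<Rightarrow> 'v) urep"
  where "induced_rep G H W =
    \<lparr>rep_space = {F. (\<forall>g\<in>carrier G. F g \<in> rep_space W) \<and>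
        (\<forall>g. g \<notin> carrier G \<longrightarrow> F g = 0) \<and>
        (\<forall>h\<in>H. \<forall>g\<in>carrier G. F (h \<otimes>\<^bsub>G\<^esub> g) = rep_act W h (F g))},
     rep_scale = (\<lambda>c F g. rep_scale W c (F g)),
     rep_inner = (\<lambda>F F'. (\<Sum>g\<in>carrier G. rep_inner W (F g) (F' g)) / of_nat (card H)),
     rep_act = (\<lambda>g F x. if x \<in> carrier G then F (x \<otimes>\<^bsub>G\<^esub> g) else 0)\<rparr>"

section \<open>Wreath products and characters\<close>

definition power_group :: "('a, 'm) monoid_scheme \<Rightarrow> nat \<Rightarrow> (nat \<Rightarrow> 'a) monoid"
  where "power_group A n = product_group {1..n} (\<lambda>_. A)"

definition perm_act :: "nat \<Rightarrow> (nat \<Rightarrow> nat) \<Rightarrow> (nat \<Rightarrow> 'a) \<Rightarrow> nat \<Rightarrow> 'a"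
  where "perm_act n p z = (\<lambda>i\<in>{1..n}. z (inv' p i))"

definition wreath :: "('a, 'm) monoid_scheme \<Rightarrow> nat \<Rightarrow> ((nat \<Rightarrow> 'a) \<times> (nat \<Rightarrow> nat)) monoid"
  where "wreath A n =
    \<lparr>carrier = carrier (power_group A n) \<times> carrier (sym_group n),
     mult = (\<lambda>(g, p) (h, s). (g \<otimes>\<^bsub>power_group A n\<^esub> perm_act n p h, p \<otimes>\<^bsub>sym_group n\<^esub> s)),
     one = (\<one>\<^bsub>power_group A n\<^esub>, \<one>\<^bsub>sym_group n\<^esub>)\<rparr>"

definition wreath_base :: "nat \<Rightarrow> (nat \<Rightarrow> 'a) \<Rightarrow> (nat \<Rightarrow> 'a) \<times> (nat \<Rightarrow> nat)"
  where "wreath_base n x = (x, \<one>\<^bsub>sym_group n\<^esub>)"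

definition wreath_perm ::
    "('a, 'm) monoid_scheme \<Rightarrow> nat \<Rightarrow> (nat \<Rightarrow> nat) \<Rightarrow> (nat \<Rightarrow> 'a) \<times> (nat \<Rightarrow> nat)"
  where "wreath_perm A n p = (\<one>\<^bsub>power_group A n\<^esub>, p)"

definition complex_units :: "complex monoid"
  where "complex_units = \<lparr>carrier = {c. c \<noteq> 0}, mult = (*), one = 1\<rparr>"

text \<open>Extensionality makes distinct members distinct as functions on \<open>A\<close>.\<close>

definition characters :: "('a, 'm) monoid_scheme \<Rightarrow> ('a \<Rightarrow> complex) set"
  where "characters A = hom A complex_units \<inter> extensional (carrier A)"

definition pairing :: "nat \<Rightarrow> (nat \<Rightarrow> 'a \<Rightarrow> complex) \<Rightarrow> (nat \<Rightarrow> 'a) \<Rightarrow> complex"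
  where "pairing n z x = (\<Prod>i\<in>{1..n}. z i (x i))"

definition multiplicity_vector ::
    "('a, 'm) monoid_scheme \<Rightarrow> nat \<Rightarrow> (('a \<Rightarrow> complex) \<Rightarrow> nat) \<Rightarrow> bool"
  where "multiplicity_vector A n \<kappa> \<longleftrightarrow> (\<Sum>\<chi>\<in>characters A. \<kappa> \<chi>) = n"

section \<open>The representation indexed by a multiplicity vector\<close>

text \<open>
  An embedding of \<open>\<Prod>\<chi>. A \<wr> S(\<kappa> \<chi>)\<close> into \<open>A \<wr> S(n)\<close> amounts to a splitting of \<open>{1..n}\<close> into
  blocks \<open>B \<chi>\<close> of sizes \<open>\<kappa> \<chi>\<close>; the factor at \<open>\<chi>\<close> acts on the coordinates in \<open>B \<chi>\<close>. Different
  splittings give conjugate subgroups. The tensor product of the \<open>\<chi>\<^sup>\<otimes>\<^sup>\<kappa>\<close> is one-dimensional, so it is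
  realised on the complex numbers.
\<close>

definition block_system ::
    "('a, 'm) monoid_scheme \<Rightarrow> nat \<Rightarrow> (('a \<Rightarrow> complex) \<Rightarrow> nat) \<Rightarrow> (('a \<Rightarrow> complex) \<Rightarrow> nat set) \<Rightarrow> bool"
  where "block_system A n \<kappa> B \<longleftrightarrow>
    (\<Union>\<chi>\<in>characters A. B \<chi>) = {1..n} \<and>
    (\<forall>\<chi>\<in>characters A. \<forall>\<eta>\<in>characters A. \<chi> \<noteq> \<eta> \<longrightarrow> B \<chi> \<inter> B \<eta> = {}) \<and>
    (\<forall>\<chi>\<in>characters A. card (B \<chi>) = \<kappa> \<chi>)"

definition block_subgroup ::
    "('a, 'm) monoid_scheme \<Rightarrow> nat \<Rightarrow> (('a \<Rightarrow> complex) \<Rightarrow> nat set) \<Rightarrow> ((nat \<Rightarrow> 'a) \<times> (nat \<Rightarrow> nat)) set"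
  where "block_subgroup A n B =
    {(x, p) \<in> carrier (wreath A n). \<forall>\<chi>\<in>characters A. p ` B \<chi> = B \<chi>}"

definition block_rep ::
    "('a, 'm) monoid_scheme \<Rightarrow> (('a \<Rightarrow> complex) \<Rightarrow> nat set) \<Rightarrow>
      ((nat \<Rightarrow> 'a) \<times> (nat \<Rightarrow> nat), complex) urep"
  where "block_rep A B =
    \<lparr>rep_space = UNIV, rep_scale = (*), rep_inner = (\<lambda>u v. u * cnj v),
     rep_act = (\<lambda>(x, p) u. (\<Prod>\<chi>\<in>characters A. \<Prod>i\<in>B \<chi>. \<chi> (x i)) * u)\<rparr>"

definition V_kappa ::
    "('a, 'm) monoid_scheme \<Rightarrow> nat \<Rightarrow> (('a \<Rightarrow> complex) \<Rightarrow> nat set) \<Rightarrow>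
      ((nat \<Rightarrow> 'a) \<times> (nat \<Rightarrow> nat), (nat \<Rightarrow> 'a) \<times> (nat \<Rightarrow> nat) \<Rightarrow> complex) urep"
  where "V_kappa A n B = induced_rep (wreath A n) (block_subgroup A n B) (block_rep A B)"

section \<open>The realisation on functions on configurations\<close>

definition Omega ::
    "('a, 'm) monoid_scheme \<Rightarrow> nat \<Rightarrow> (('a \<Rightarrow> complex) \<Rightarrow> nat) \<Rightarrow> (nat \<Rightarrow> 'a \<Rightarrow> complex) set"
  where "Omega A n \<kappa> =
    {z \<in> {1..n} \<rightarrow>\<^sub>E characters A. \<forall>\<chi>\<in>characters A. card {i \<in> {1..n}. z i = \<chi>} = \<kappa> \<chi>}"

definition fun_space :: "'i set \<Rightarrow> ('i \<Rightarrow> complex) set"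
  where "fun_space I = {f. \<forall>z. z \<notin> I \<longrightarrow> f z = 0}"

definition fun_scale :: "complex \<Rightarrow> ('i \<Rightarrow> complex) \<Rightarrow> 'i \<Rightarrow> complex"
  where "fun_scale c f = (\<lambda>z. c * f z)"

definition basis_vec :: "'i \<Rightarrow> 'i \<Rightarrow> complex"
  where "basis_vec z = (\<lambda>u. of_bool (u = z))"

definition lin_ext :: "'i set \<Rightarrow> ('i \<Rightarrow> 'i \<Rightarrow> complex) \<Rightarrow> ('i \<Rightarrow> complex) \<Rightarrow> 'i \<Rightarrow> complex"
  where "lin_ext I b f = (\<Sum>z\<in>I. fun_scale (f z) (b z))"

text \<open>The pair \<open>(x, p)\<close> is the product of \<open>x\<close> and \<open>p\<close>, so \<open>p\<close> acts first.\<close>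

definition Omega_rep ::
    "('a, 'm) monoid_scheme \<Rightarrow> nat \<Rightarrow> (('a \<Rightarrow> complex) \<Rightarrow> nat) \<Rightarrow>
      ((nat \<Rightarrow> 'a) \<times> (nat \<Rightarrow> nat), (nat \<Rightarrow> 'a \<Rightarrow> complex) \<Rightarrow> complex) urep"
  where "Omega_rep A n \<kappa> =
    \<lparr>rep_space = fun_space (Omega A n \<kappa>),
     rep_scale = fun_scale,
     rep_inner = (\<lambda>f g. \<Sum>z\<in>Omega A n \<kappa>. f z * cnj (g z)),
     rep_act = (\<lambda>(x, p) f.
       lin_ext (Omega A n \<kappa>) (\<lambda>z. fun_scale (pairing n z x) (basis_vec z))
         (lin_ext (Omega A n \<kappa>) (\<lambda>z. basis_vec (perm_act n p z)) f))\<rparr>"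

definition w_T ::
    "('a, 'm) monoid_scheme \<Rightarrow> nat \<Rightarrow> (nat \<Rightarrow> nat \<Rightarrow> real) \<Rightarrow> (nat \<Rightarrow> 'a) \<times> (nat \<Rightarrow> nat) \<Rightarrow> real"
  where "w_T A n a =
    (\<lambda>g. \<Sum>i\<in>{1..n}. \<Sum>j\<in>{i<..n}. a i j * galg_of (wreath_perm A n (transpose i j)) g)"

definition w_N ::
    "('a, 'm) monoid_scheme \<Rightarrow> nat \<Rightarrow> ((nat \<Rightarrow> 'a) \<Rightarrow> real) \<Rightarrow> (nat \<Rightarrow> 'a) \<times> (nat \<Rightarrow> nat) \<Rightarrow> real"
  where "w_N A n c =
    (\<lambda>g. \<Sum>x\<in>carrier (power_group A n). c x * galg_of (wreath_base n x) g)"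

definition Q_pot ::
    "('a, 'm) monoid_scheme \<Rightarrow> nat \<Rightarrow> ((nat \<Rightarrow> 'a) \<Rightarrow> real) \<Rightarrow> (nat \<Rightarrow> 'a \<Rightarrow> complex) \<Rightarrow> real"
  where "Q_pot A n c z = (\<Sum>x\<in>carrier (power_group A n). c x * (1 - Re (pairing n z x)))"

definition L_kappa ::
    "('a, 'm) monoid_scheme \<Rightarrow> nat \<Rightarrow> (('a \<Rightarrow> complex) \<Rightarrow> nat) \<Rightarrow>
      (nat \<Rightarrow> nat \<Rightarrow> real) \<Rightarrow> ((nat \<Rightarrow> 'a) \<Rightarrow> real) \<Rightarrow>
      ((nat \<Rightarrow> 'a \<Rightarrow> complex) \<Rightarrow> complex) \<Rightarrow> (nat \<Rightarrow> 'a \<Rightarrow> complex) \<Rightarrow> complex"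
  where "L_kappa A n \<kappa> a c f =
    (\<lambda>z. if z \<in> Omega A n \<kappa> then
        (\<Sum>i\<in>{1..n}. \<Sum>j\<in>{i<..n}.
          complex_of_real (a i j) * (f z - f (perm_act n (transpose i j) z))) +
        complex_of_real (Q_pot A n c z) * f z
      else 0)"

end

theory Submission
  imports Defs "HOL-Algebra.Multiplicative_Group"
begin

text \<open>
  Let \<open>H\<close> be the subgroup from which \<open>V\<^sub>\<kappa>\<close> is induced. It is the stabiliser of the configuration that
  takes the value \<open>\<chi>\<close> on the block of \<open>\<chi>\<close>, so its cosets are the points of \<open>\<Omega>\<^sub>\<kappa>\<close>, and an
  \<open>H\<close>-equivariant function is determined by its values at permutations, that is, by a function on
  \<open>\<Omega>\<^sub>\<kappa>\<close>. The Laplacian acts as \<open>\<Sum>\<^sub>h w(h)(v - hv)\<close>; the symmetry of \<open>c\<close> makes the diagonal part real.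
  A fixed function on \<open>\<Omega>\<^sub>\<kappa>\<close> is constant because \<open>S\<^sub>n\<close> acts transitively, and if it is non-zero then
  every pairing \<open>\<langle>z, x\<rangle>\<close> is \<open>1\<close>; then only the trivial character occurs and the representation is
  trivial. Hence a non-trivial \<open>V\<^sub>\<kappa>\<close> has no fixed vectors, and \<open>\<psi>\<close> is a minimum over the whole spectrum.
\<close>

section \<open>Representations and the group algebra\<close>

lemma sum_fun_apply: "(\<Sum>i\<in>I. f i) x = (\<Sum>i\<in>I. (f i x :: 'b::comm_monoid_add))"
  by (induction I rule: infinite_finite_induct) auto

lemma vector_space_fun_scale: "vector_space fun_scale"
  by unfold_locales (auto simp: fun_scale_def fun_eq_iff algebra_simps)

interpretation fun_vs: vector_space fun_scale
  by (rule vector_space_fun_scale)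

lemma subspace_fun_space: "fun_vs.subspace (fun_space I)"
  by (auto simp: fun_vs.subspace_def fun_space_def fun_scale_def)

lemma fun_space_span:
  assumes "finite I"
  shows "fun_space I \<subseteq> fun_vs.span (basis_vec ` I)"
proof
  fix f :: "'a \<Rightarrow> complex" assume f: "f \<in> fun_space I"
  have "f = (\<Sum>z\<in>I. fun_scale (f z) (basis_vec z))"
  proof
    fix u
    have "(\<Sum>z\<in>I. fun_scale (f z) (basis_vec z)) u = (\<Sum>z\<in>I. if u = z then f z else 0)"
      unfolding sum_fun_apply by (intro sum.cong) (auto simp: fun_scale_def basis_vec_def)
    then show "f u = (\<Sum>z\<in>I. fun_scale (f z) (basis_vec z)) u"
      using f assms by (auto simp: fun_space_def)
  qed
  also have "\<dots> \<in> fun_vs.span (basis_vec ` I)"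
    by (intro fun_vs.span_sum fun_vs.span_scale fun_vs.span_base) auto
  finally show "f \<in> fun_vs.span (basis_vec ` I)" .
qed

text \<open>A maximal independent subset of \<open>U\<close> spans \<open>U\<close>, and it is
  finite because it lies in the span of the finitely many basis vectors. This gives a spanning set
  inside \<open>U\<close> without an explicit basis, as is convenient for equivariant
  functions.\<close>

lemma fun_subspace_finite_dim:
  assumes "finite I" "fun_vs.subspace U" "U \<subseteq> fun_space I"
  shows "\<exists>S. finite S \<and> S \<subseteq> U \<and> fun_vs.span S = U"
proof -
  obtain S where S: "S \<subseteq> U" "fun_vs.independent S" "U \<subseteq> fun_vs.span S"
    by (rule fun_vs.maximal_independent_subset)
  have "finite S"
    using fun_vs.independent_span_bound[of "basis_vec ` I" S] fun_space_span[OF assms(1)] S assms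
    by auto
  moreover have "fun_vs.span S \<subseteq> U"
    using S(1) assms(2) by (rule fun_vs.span_minimal)
  ultimately show ?thesis using S by blast
qed

section \<open>The Laplacian in a unitary representation\<close>

context unitary_rep
begin

sublocale vs: vector_space "rep_scale R"
  by (rule vector_space)

lemma zero_mem: "0 \<in> rep_space R"
  using subspace by (rule vs.subspace_0)

lemma galg_act_mem: "v \<in> rep_space R \<Longrightarrow> galg_act G R w v \<in> rep_space R"
  unfolding galg_act_def
  by (intro vs.subspace_sum[OF subspace] vs.subspace_scale[OF subspace] act_closed)

text \<open>Each coefficient function \<open>galg_of k\<close> acts as the element \<open>k\<close>,
  so after the two sums are interchanged the inner one collapses to \<open>v\<close> or to
  \<open>rep_act R h v\<close>.\<close>

lemma galg_act_lap:
  assumes "finite (carrier G)" "v \<in> rep_space R"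
  shows "galg_act G R (galg_lap G w) v =
    (\<Sum>h\<in>carrier G. rep_scale R (complex_of_real (w h)) (v - rep_act R h v))"
proof -
  have delta: "(\<Sum>g\<in>carrier G. rep_scale R (complex_of_real (galg_of k g)) (rep_act R g v)) =
      rep_act R k v" if "k \<in> carrier G" for k
  proof -
    have "(\<Sum>g\<in>carrier G. rep_scale R (complex_of_real (galg_of k g)) (rep_act R g v)) =
        (\<Sum>g\<in>carrier G. if g = k then rep_act R k v else 0)"
      by (intro sum.cong) (auto simp: galg_of_def)
    then show ?thesis using that assms(1) by simp
  qed
  have "galg_act G R (galg_lap G w) v =
      (\<Sum>g\<in>carrier G. \<Sum>h\<in>carrier G. rep_scale R (complex_of_real (w h))
        (rep_scale R (complex_of_real (galg_of \<one> g)) (rep_act R g v) -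
         rep_scale R (complex_of_real (galg_of h g)) (rep_act R g v)))"
    unfolding galg_act_def galg_lap_def
    by (intro sum.cong)
      (simp_all add: vs.scale_sum_left algebra_simps vs.scale_right_diff_distrib vs.scale_left_diff_distrib)
  also have "\<dots> = (\<Sum>h\<in>carrier G. rep_scale R (complex_of_real (w h))
      ((\<Sum>g\<in>carrier G. rep_scale R (complex_of_real (galg_of \<one> g)) (rep_act R g v)) -
       (\<Sum>g\<in>carrier G. rep_scale R (complex_of_real (galg_of h g)) (rep_act R g v))))"
    by (subst sum.swap) (simp add: vs.scale_sum_right sum_subtractf vs.scale_right_diff_distrib)
  also have "\<dots> = (\<Sum>h\<in>carrier G. rep_scale R (complex_of_real (w h)) (v - rep_act R h v))"
    by (intro sum.cong) (simp_all add: delta act_one assms(2))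
  finally show ?thesis .
qed

lemma inner_zero_left: "v \<in> rep_space R \<Longrightarrow> rep_inner R 0 v = 0"
  using inner_scale[of 0 v 0] zero_mem by simp

text \<open>When there are no non-zero fixed vectors, this turns the minimum in \<open>psi\<close>
  into one over the whole representation space.\<close>

lemma orth_compl_zero: "orth_compl R {0} = rep_space R"
  by (auto simp: orth_compl_def inner_zero_left)

end

text \<open>A \<open>rep_iso\<close> is linear and equivariant but may change the inner product. The
  inner product enters \<open>psi\<close> only through the complement of the fixed space; that space
  is zero here on both sides, so the complement is everything and the isomorphism suffices.\<close>

lemma psi_eq_of_rep_iso:
  assumes "unitary_rep G R" "unitary_rep G S" "rep_iso G R S"
    and nontriv: "nontrivial_rep G R"
    and fixed: "nontrivial_rep G S \<Longrightarrow> fixed_space G S \<subseteq> {0}"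
  shows "psi G w R =
    ereal (least_eigenvalue (rep_scale S) (rep_space S) (galg_act G S (galg_lap G w)))"
proof -
  interpret R: unitary_rep G R by fact
  interpret S: unitary_rep G S by fact
  obtain T where bij: "bij_betw T (rep_space R) (rep_space S)"
    and add: "\<And>u v. \<lbrakk>u \<in> rep_space R; v \<in> rep_space R\<rbrakk> \<Longrightarrow> T (u + v) = T u + T v"
    and scale: "\<And>c u. u \<in> rep_space R \<Longrightarrow> T (rep_scale R c u) = rep_scale S c (T u)"
    and act: "\<And>g u. \<lbrakk>g \<in> carrier G; u \<in> rep_space R\<rbrakk> \<Longrightarrow> T (rep_act R g u) = rep_act S g (T u)"
    using assms(3) unfolding rep_iso_def by blast
  have inj: "T u = T v \<longleftrightarrow> u = v" if "u \<in> rep_space R" "v \<in> rep_space R" for u v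
    using bij that by (auto simp: bij_betw_def inj_on_def)
  have mem: "T u \<in> rep_space S" if "u \<in> rep_space R" for u
    using bij that by (auto simp: bij_betw_def)
  have img: "T ` rep_space R = rep_space S"
    using bij by (simp add: bij_betw_def)
  have zero: "T 0 = 0"
    using scale[OF R.zero_mem, of 0] by simp
  have sum: "T (\<Sum>i\<in>I. f i) = (\<Sum>i\<in>I. T (f i))"
    if "\<And>i. i \<in> I \<Longrightarrow> f i \<in> rep_space R" for I and f :: "_ \<Rightarrow> 'c"
    using that
    by (induction I rule: infinite_finite_induct)
      (auto simp: zero add R.vs.subspace_sum[OF R.subspace])
  have galg: "T (galg_act G R u v) = galg_act G S u (T v)" if "v \<in> rep_space R" for u v
    using that unfolding galg_act_def
    by (subst sum) (auto simp: scale act R.act_closed R.vs.subspace_scale[OF R.subspace])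
  have "nontrivial_rep G S"
    using nontriv inj mem act R.act_closed unfolding nontrivial_rep_def by metis
  then have fixS: "fixed_space G S \<subseteq> {0}" by (rule fixed)
  have "0 \<in> fixed_space G R"
  proof -
    have "rep_act R g 0 = 0" if "g \<in> carrier G" for g
      using R.act_scale[OF that R.zero_mem, of 0] by simp
    then show ?thesis by (simp add: fixed_space_def R.zero_mem)
  qed
  moreover have "v = 0" if "v \<in> fixed_space G R" for v
  proof -
    have v: "v \<in> rep_space R" "\<And>g. g \<in> carrier G \<Longrightarrow> rep_act R g v = v"
      using that by (auto simp: fixed_space_def)
    then have "T v \<in> fixed_space G S"
      using mem act[symmetric] by (auto simp: fixed_space_def)
    then show ?thesis using fixS zero inj[OF v(1) R.zero_mem] by auto
  qed
  ultimately have fixR: "fixed_space G R = {0}" by blast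
  \<comment> \<open>Non-triviality rules out the infinite branch of \<open>psi\<close>.\<close>
  have "fixed_space G R \<noteq> rep_space R"
    using nontriv by (auto simp: nontrivial_rep_def fixed_space_def)
  \<comment> \<open>The sets under \<open>Min\<close> coincide: \<open>T\<close> takes non-zero
    eigenvectors to non-zero eigenvectors with the same eigenvalue, in both directions.\<close>
  moreover have "least_eigenvalue (rep_scale R) (rep_space R) (galg_act G R u) =
      least_eigenvalue (rep_scale S) (rep_space S) (galg_act G S u)" for u
  proof -
    have "(\<exists>v\<in>rep_space R. v \<noteq> 0 \<and> galg_act G R u v = rep_scale R x v) \<longleftrightarrow>
        (\<exists>v\<in>rep_space S. v \<noteq> 0 \<and> galg_act G S u v = rep_scale S x v)" for x
    proof -
      have "galg_act G R u v = rep_scale R x v \<longleftrightarrow> galg_act G S u (T v) = rep_scale S x (T v)"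
        if "v \<in> rep_space R" for v
        using that inj[of "galg_act G R u v" "rep_scale R x v"]
        by (simp add: galg scale R.galg_act_mem R.vs.subspace_scale[OF R.subspace])
      moreover have "v = 0 \<longleftrightarrow> T v = 0" if "v \<in> rep_space R" for v
        using inj[OF that R.zero_mem] zero by simp
      ultimately show ?thesis unfolding img[symmetric] by auto
    qed
    then show ?thesis by (simp add: least_eigenvalue_def)
  qed
  ultimately show ?thesis
    by (simp add: psi_def fixR R.orth_compl_zero)
qed

section \<open>Wreath products\<close>

declare One_nat_def [simp del] \<comment> \<open>keeps \<open>{1..n}\<close> from turning into \<open>{Suc 0..n}\<close>\<close>

lemma carrier_power_group [simp]: "carrier (power_group A n) = {1..n} \<rightarrow>\<^sub>E carrier A"
  by (simp add: power_group_def)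

lemma carrier_wreath:
  "carrier (wreath A n) = ({1..n} \<rightarrow>\<^sub>E carrier A) \<times> {p. p permutes {1..n}}"
  by (simp add: wreath_def sym_group_def)

lemma mult_wreath:
  "(x, p) \<otimes>\<^bsub>wreath A n\<^esub> (y, q) = (\<lambda>i\<in>{1..n}. x i \<otimes>\<^bsub>A\<^esub> perm_act n p y i, p \<circ> q)"
  by (simp add: wreath_def sym_group_def power_group_def)

lemma one_wreath: "\<one>\<^bsub>wreath A n\<^esub> = (\<lambda>i\<in>{1..n}. \<one>\<^bsub>A\<^esub>, id)"
  by (simp add: wreath_def sym_group_def power_group_def)

lemma finite_carrier_wreath:
  "finite (carrier A) \<Longrightarrow> finite (carrier (wreath A n))"
  by (simp add: carrier_wreath finite_PiE finite_permutations)

lemma perm_act_apply: "i \<in> {1..n} \<Longrightarrow> perm_act n p z i = z (inv' p i)"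
  by (simp add: perm_act_def)

lemma perm_act_PiE:
  assumes "p permutes {1..n}" "z \<in> {1..n} \<rightarrow>\<^sub>E S"
  shows "perm_act n p z \<in> {1..n} \<rightarrow>\<^sub>E S"
  unfolding perm_act_def
  using assms permutes_in_image[OF permutes_inv[OF assms(1)]]
  by (intro restrict_PiE_iff[THEN iffD2]) (auto simp: PiE_iff)

lemma perm_act_id: "z \<in> extensional {1..n} \<Longrightarrow> perm_act n id z = z"
  by (simp add: perm_act_def extensional_restrict)

text \<open>The inverse in \<open>perm_act\<close> makes it a left action. Since
  \<open>inv' p\<close> preserves \<open>{1..n}\<close>, the inner restriction is never evaluated
  outside its domain.\<close>

lemma perm_act_comp:
  assumes "p permutes {1..n}" "q permutes {1..n}"
  shows "perm_act n (p \<circ> q) z = perm_act n p (perm_act n q z)"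
proof
  fix i
  show "perm_act n (p \<circ> q) z i = perm_act n p (perm_act n q z) i"
    using permutes_in_image[OF permutes_inv[OF assms(1)], of i]
    by (simp add: perm_act_def o_inv_distrib[OF permutes_bij[OF assms(1)] permutes_bij[OF assms(2)]])
qed

lemma perm_act_inv_cancel:
  assumes "p permutes {1..n}" "z \<in> extensional {1..n}"
  shows "perm_act n (inv' p) (perm_act n p z) = z" "perm_act n p (perm_act n (inv' p) z) = z"
  using perm_act_comp[OF permutes_inv[OF assms(1)] assms(1), of z]
    perm_act_comp[OF assms(1) permutes_inv[OF assms(1)], of z]
  by (simp_all only: perm_act_id[OF assms(2)] permutes_inv_o[OF assms(1)])

lemma group_wreath:
  assumes "group A"
  shows "group (wreath A n)"
proof -
  interpret A: group A by fact
  have [simp]: "perm_act n p x i \<in> carrier A"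
    if "p permutes {1..n}" "x \<in> {1..n} \<rightarrow>\<^sub>E carrier A" "i \<in> {1..n}" for p x i
    using perm_act_PiE[OF that(1,2)] that(3) by auto
  have mult_closed: "g \<otimes>\<^bsub>wreath A n\<^esub> h \<in> carrier (wreath A n)"
    if "g \<in> carrier (wreath A n)" "h \<in> carrier (wreath A n)" for g h
    using that by (cases g; cases h) (auto simp: mult_wreath carrier_wreath permutes_compose)
  \<comment> \<open>Permutations respect the coordinatewise multiplication; associativity of the
    semidirect product rests on this.\<close>
  have dist: "perm_act n p (\<lambda>i\<in>{1..n}. x i \<otimes>\<^bsub>A\<^esub> y i) =
      (\<lambda>i\<in>{1..n}. perm_act n p x i \<otimes>\<^bsub>A\<^esub> perm_act n p y i)" if "p permutes {1..n}" for p x y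
    using permutes_in_image[OF permutes_inv[OF that]] by (auto simp: perm_act_def fun_eq_iff)
  have [simp]: "x i \<in> carrier A" if "x \<in> {1..n} \<rightarrow>\<^sub>E carrier A" "i \<in> {1..n}" for x i
    using that by auto
  show ?thesis
  proof (rule groupI)
    show "\<one>\<^bsub>wreath A n\<^esub> \<in> carrier (wreath A n)"
      by (auto simp: one_wreath carrier_wreath permutes_id)
  next
    fix g h k
    assume "g \<in> carrier (wreath A n)" "h \<in> carrier (wreath A n)" "k \<in> carrier (wreath A n)"
    then show "g \<otimes>\<^bsub>wreath A n\<^esub> h \<otimes>\<^bsub>wreath A n\<^esub> k = g \<otimes>\<^bsub>wreath A n\<^esub> (h \<otimes>\<^bsub>wreath A n\<^esub> k)"
      by (cases g; cases h; cases k)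
        (auto simp: mult_wreath carrier_wreath dist perm_act_comp perm_act_PiE A.m_assoc o_assoc
          intro!: restrict_ext)
  next
    fix g assume g: "g \<in> carrier (wreath A n)"
    then show "\<one>\<^bsub>wreath A n\<^esub> \<otimes>\<^bsub>wreath A n\<^esub> g = g"
      by (cases g) (auto simp: mult_wreath one_wreath carrier_wreath perm_act_id PiE_iff
          extensional_def fun_eq_iff)
    obtain x p where [simp]: "g = (x, p)" by (cases g)
    have p: "p permutes {1..n}" and x: "x \<in> {1..n} \<rightarrow>\<^sub>E carrier A"
      using g by (auto simp: carrier_wreath)
    \<comment> \<open>A left inverse \<open>(y, inv' p)\<close> must satisfy y (p^-1 . x) = 1, so y
      is p^-1 applied to the coordinatewise inverse of \<open>x\<close>.\<close>
    let ?h = "(perm_act n (inv' p) (\<lambda>i\<in>{1..n}. inv\<^bsub>A\<^esub> (x i)), inv' p)"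
    have "?h \<in> carrier (wreath A n)"
      using p x by (auto simp: carrier_wreath permutes_inv intro!: perm_act_PiE)
    moreover have "?h \<otimes>\<^bsub>wreath A n\<^esub> g = \<one>\<^bsub>wreath A n\<^esub>"
      using p x permutes_in_image[OF p]
      by (auto simp: mult_wreath one_wreath permutes_inv_o perm_act_def permutes_inv_inv
          intro!: restrict_ext)
    ultimately show "\<exists>h\<in>carrier (wreath A n). h \<otimes>\<^bsub>wreath A n\<^esub> g = \<one>\<^bsub>wreath A n\<^esub>"
      by blast
  qed (rule mult_closed)
qed

section \<open>Characters and configurations\<close>

lemma character_mult:
  "\<lbrakk>\<chi> \<in> characters A; x \<in> carrier A; y \<in> carrier A\<rbrakk> \<Longrightarrow> \<chi> (x \<otimes>\<^bsub>A\<^esub> y) = \<chi> x * \<chi> y"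
  by (auto simp: characters_def hom_def complex_units_def)

lemma character_nonzero: "\<lbrakk>\<chi> \<in> characters A; x \<in> carrier A\<rbrakk> \<Longrightarrow> \<chi> x \<noteq> 0"
  by (auto simp: characters_def hom_def complex_units_def)

lemma character_one:
  assumes "group A" "\<chi> \<in> characters A"
  shows "\<chi> \<one>\<^bsub>A\<^esub> = 1"
proof -
  interpret group A by fact
  have "\<chi> \<one>\<^bsub>A\<^esub> * \<chi> \<one>\<^bsub>A\<^esub> = \<chi> \<one>\<^bsub>A\<^esub>"
    using character_mult[OF assms(2), of "\<one>\<^bsub>A\<^esub>" "\<one>\<^bsub>A\<^esub>"] by simp
  then show ?thesis using character_nonzero[OF assms(2) one_closed] by simp
qed

text \<open>The order of the group annihilates \<open>x\<close>, so the value of the character is a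
  root of unity.\<close>

lemma character_norm:
  assumes "group A" "finite (carrier A)" "\<chi> \<in> characters A" "x \<in> carrier A"
  shows "norm (\<chi> x) = 1"
proof -
  interpret group A by fact
  have pow: "\<chi> (x [^]\<^bsub>A\<^esub> k) = \<chi> x ^ k" for k :: nat
    by (induction k) (simp_all add: character_one assms character_mult mult.commute)
  have "\<chi> x ^ order A = 1"
    using pow[of "order A"] by (simp add: pow_order_eq_1 character_one assms)
  then have "norm (\<chi> x) ^ order A = 1"
    by (metis norm_one norm_power)
  moreover have "order A > 0"
    using assms(2) order_gt_0_iff_finite by blast
  ultimately show ?thesis
    using power_eq_imp_eq_base[of "norm (\<chi> x)" "order A" 1] by simp
qed

text \<open>Both sides are inverse to \<open>\<chi> x\<close>: the left by multiplicativity, the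
  right because \<open>\<chi> x\<close> has norm 1.\<close>

lemma character_inv:
  assumes "group A" "finite (carrier A)" "\<chi> \<in> characters A" "x \<in> carrier A"
  shows "\<chi> (inv\<^bsub>A\<^esub> x) = cnj (\<chi> x)"
proof -
  interpret group A by fact
  have "\<chi> (inv\<^bsub>A\<^esub> x) * \<chi> x = 1"
    using character_mult[OF assms(3), of "inv\<^bsub>A\<^esub> x" x] assms(4)
    by (simp add: character_one assms)
  moreover have "cnj (\<chi> x) * \<chi> x = 1"
    using character_norm[OF assms] complex_norm_square[of "\<chi> x"] by (simp add: mult.commute)
  ultimately show ?thesis
    by (metis character_nonzero[OF assms(3,4)] mult_right_cancel)
qed

context
  fixes A :: "('a, 'm) monoid_scheme" and n :: nat
begin

section \<open>The pairing of tuples of characters with tuples of group elements\<close>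

lemma pairing_mult:
  assumes "z \<in> {1..n} \<rightarrow>\<^sub>E characters A" "x \<in> {1..n} \<rightarrow>\<^sub>E carrier A" "y \<in> {1..n} \<rightarrow>\<^sub>E carrier A"
  shows "pairing n z (\<lambda>i\<in>{1..n}. x i \<otimes>\<^bsub>A\<^esub> y i) = pairing n z x * pairing n z y"
  unfolding pairing_def prod.distrib[symmetric]
  using assms by (intro prod.cong) (auto simp: PiE_iff character_mult)

lemma pairing_one:
  assumes "group A" "z \<in> {1..n} \<rightarrow>\<^sub>E characters A"
  shows "pairing n z (\<lambda>i\<in>{1..n}. \<one>\<^bsub>A\<^esub>) = 1"
  unfolding pairing_def
  using assms by (intro prod.neutral) (auto simp: PiE_iff character_one)

lemma norm_pairing:
  assumes "group A" "finite (carrier A)"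
    and "z \<in> {1..n} \<rightarrow>\<^sub>E characters A" "x \<in> {1..n} \<rightarrow>\<^sub>E carrier A"
  shows "norm (pairing n z x) = 1"
  unfolding pairing_def prod_norm[symmetric]
  using assms by (intro prod.neutral) (auto simp: PiE_iff character_norm)

lemma pairing_inv:
  assumes "group A" "finite (carrier A)"
    and "z \<in> {1..n} \<rightarrow>\<^sub>E characters A" "x \<in> {1..n} \<rightarrow>\<^sub>E carrier A"
  shows "pairing n z (inv\<^bsub>power_group A n\<^esub> x) = cnj (pairing n z x)"
  unfolding pairing_def power_group_def cnj_prod
  using assms by (intro prod.cong) (auto simp: PiE_iff character_inv)

text \<open>Reindexing the product along \<open>p\<close> moves the permutation to the other
  argument, where it becomes its inverse. This is how the diagonal action of tuples is matched with
  the semidirect multiplication.\<close>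

lemma pairing_perm_act:
  assumes "p permutes {1..n}"
  shows "pairing n z (perm_act n p x) = pairing n (perm_act n (inv' p) z) x"
proof -
  have "pairing n z (perm_act n p x) = (\<Prod>i\<in>{1..n}. z i (x (inv' p i)))"
    unfolding pairing_def by (intro prod.cong) (auto simp: perm_act_def)
  also have "\<dots> = (\<Prod>i\<in>{1..n}. z (p i) (x (inv' p (p i))))"
    using prod.permute[OF assms, of "\<lambda>i. z i (x (inv' p i))"] by (simp add: o_def)
  also have "\<dots> = pairing n (perm_act n (inv' p) z) x"
    unfolding pairing_def
    by (intro prod.cong) (auto simp: perm_act_def permutes_inv_inv[OF assms] permutes_inverses[OF assms])
  finally show ?thesis .
qed

section \<open>Configurations and the action of permutations on them\<close>

lemma Omega_PiE: "z \<in> Omega A n \<kappa> \<Longrightarrow> z \<in> {1..n} \<rightarrow>\<^sub>E characters A"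
  by (simp add: Omega_def)

lemma Omega_extensional: "z \<in> Omega A n \<kappa> \<Longrightarrow> z \<in> extensional {1..n}"
  by (auto simp: Omega_def PiE_def)

text \<open>The permutation \<open>p\<close> carries each fibre of \<open>z\<close> bijectively onto
  the corresponding fibre of the permuted configuration, so the multiplicities are
  preserved.\<close>

lemma perm_act_Omega:
  assumes p: "p permutes {1..n}" and z: "z \<in> Omega A n \<kappa>"
  shows "perm_act n p z \<in> Omega A n \<kappa>"
proof -
  have "card {i \<in> {1..n}. perm_act n p z i = \<chi>} = card {i \<in> {1..n}. z i = \<chi>}" for \<chi>
  proof -
    have "{i \<in> {1..n}. perm_act n p z i = \<chi>} = p ` {i \<in> {1..n}. z i = \<chi>}"
    proof (intro equalityI subsetI)
      fix i assume "i \<in> {i \<in> {1..n}. perm_act n p z i = \<chi>}"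
      then show "i \<in> p ` {i \<in> {1..n}. z i = \<chi>}"
        using permutes_in_image[OF permutes_inv[OF p], of i]
        by (intro image_eqI[of _ _ "inv' p i"]) (auto simp: perm_act_def permutes_inverses[OF p])
    next
      fix i assume "i \<in> p ` {i \<in> {1..n}. z i = \<chi>}"
      then show "i \<in> {i \<in> {1..n}. perm_act n p z i = \<chi>}"
        using permutes_in_image[OF p] by (auto simp: perm_act_def permutes_inverses[OF p])
    qed
    then show ?thesis
      by (simp add: card_image inj_on_subset[OF permutes_inj[OF p]])
  qed
  then show ?thesis
    using z perm_act_PiE[OF p Omega_PiE[OF z]] by (simp add: Omega_def)
qed

lemma bij_betw_perm_act_Omega:
  assumes "p permutes {1..n}"
  shows "bij_betw (perm_act n p) (Omega A n \<kappa>) (Omega A n \<kappa>)"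
  by (rule bij_betwI[where g = "perm_act n (inv' p)"])
    (auto simp: perm_act_Omega assms permutes_inv perm_act_inv_cancel Omega_extensional)

text \<open>Two configurations have the same multiset of values, hence differ by a permutation of
  the coordinates. The relation obtained is that \<open>z\<close> is \<open>u\<close> composed with
  \<open>p\<close>, which in terms of \<open>perm_act\<close> is the action of
  \<open>inv' p\<close>.\<close>

lemma Omega_transitive:
  assumes "z \<in> Omega A n \<kappa>" "u \<in> Omega A n \<kappa>"
  obtains p where "p permutes {1..n}" "perm_act n (inv' p) u = z"
proof -
  have "count (image_mset z (mset_set {1..n})) \<chi> = count (image_mset u (mset_set {1..n})) \<chi>" for \<chi>
  proof (cases "\<chi> \<in> characters A")
    case True
    then show ?thesis
      using assms by (simp add: count_image_mset_eq_card_vimage Omega_def)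
  next
    \<comment> \<open>The multiplicities constrain only characters, but a configuration takes no
      other values.\<close>
    case False
    then have "{i \<in> {1..n}. z i = \<chi>} = {}" "{i \<in> {1..n}. u i = \<chi>} = {}"
      using assms[THEN Omega_PiE] by auto
    then show ?thesis by (simp only: count_image_mset_eq_card_vimage finite_atLeastAtMost)
  qed
  then have "image_mset z (mset_set {1..n}) = image_mset u (mset_set {1..n})"
    by (rule multiset_eqI)
  then obtain p where p: "p permutes {1..n}" "\<forall>i\<in>{1..n}. z i = u (p i)"
    using image_mset_eq_implies_permutes[of "{1..n}" z u] by auto
  have "perm_act n (inv' p) u = z"
    using p(2) Omega_extensional[OF assms(1)]
    by (auto simp: perm_act_def permutes_inv_inv[OF p(1)] extensional_def fun_eq_iff)
  with p(1) show thesis by (rule that)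
qed

section \<open>The unitary representation on functions of configurations\<close>

lemma Omega_rep_simps:
  "rep_space (Omega_rep A n \<kappa>) = fun_space (Omega A n \<kappa>)"
  "rep_scale (Omega_rep A n \<kappa>) = fun_scale"
  "rep_inner (Omega_rep A n \<kappa>) f g = (\<Sum>z\<in>Omega A n \<kappa>. f z * cnj (g z))"
  by (simp_all add: Omega_rep_def)

lemma finite_Omega: "finite (characters A) \<Longrightarrow> finite (Omega A n \<kappa>)"
  by (rule finite_subset[of _ "{1..n} \<rightarrow>\<^sub>E characters A"]) (auto simp: Omega_def finite_PiE)

text \<open>Pointwise form of an action defined on basis vectors: the only basis vector sent to a
  multiple of the one at \<open>u\<close> sits at p^-1 . u. The pairing is taken at \<open>u\<close>
  because the permutation acts before the tuple.\<close>

lemma Omega_rep_act: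
  assumes fin: "finite (characters A)" and p: "p permutes {1..n}"
  shows "rep_act (Omega_rep A n \<kappa>) (x, p) f u =
    (if u \<in> Omega A n \<kappa> then pairing n u x * f (perm_act n (inv' p) u) else 0)"
proof -
  let ?\<Omega> = "Omega A n \<kappa>"
  have fin\<Omega>: "finite ?\<Omega>" by (rule finite_Omega[OF fin])
  have perm: "lin_ext ?\<Omega> (\<lambda>z. basis_vec (perm_act n p z)) f u =
      (if u \<in> ?\<Omega> then f (perm_act n (inv' p) u) else 0)" for u
  proof -
    have "lin_ext ?\<Omega> (\<lambda>z. basis_vec (perm_act n p z)) f u =
        (\<Sum>z\<in>?\<Omega>. if u \<in> ?\<Omega> \<and> z = perm_act n (inv' p) u then f z else 0)"
      unfolding lin_ext_def sum_fun_apply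
    proof (intro sum.cong refl)
      fix z assume z: "z \<in> ?\<Omega>"
      \<comment> \<open>Permuted configurations stay in \<open>?\<Omega>\<close>, so a point
        \<open>u\<close> outside meets none of them.\<close>
      then have "u = perm_act n p z \<longleftrightarrow> u \<in> ?\<Omega> \<and> z = perm_act n (inv' p) u"
        using perm_act_inv_cancel[OF p] Omega_extensional perm_act_Omega[OF p z] by metis
      then show "fun_scale (f z) (basis_vec (perm_act n p z)) u =
          (if u \<in> ?\<Omega> \<and> z = perm_act n (inv' p) u then f z else 0)"
        by (simp add: fun_scale_def basis_vec_def)
    qed
    also have "\<dots> = (if u \<in> ?\<Omega> then f (perm_act n (inv' p) u) else 0)"
      using fin\<Omega> perm_act_Omega[OF permutes_inv[OF p]] by auto
    finally show ?thesis .
  qed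
  have "lin_ext ?\<Omega> (\<lambda>z. fun_scale (pairing n z x) (basis_vec z)) g u =
      (if u \<in> ?\<Omega> then pairing n u x * g u else 0)" for g
  proof -
    have "lin_ext ?\<Omega> (\<lambda>z. fun_scale (pairing n z x) (basis_vec z)) g u =
        (\<Sum>z\<in>?\<Omega>. if u = z then pairing n u x * g u else 0)"
      unfolding lin_ext_def sum_fun_apply
      by (intro sum.cong) (auto simp: fun_scale_def basis_vec_def)
    then show ?thesis using fin\<Omega> by simp
  qed
  then show ?thesis by (simp add: Omega_rep_def perm)
qed

end

lemma unitary_rep_Omega_rep:
  fixes A :: "('a, 'm) monoid_scheme"
  assumes "group A" "finite (carrier A)" "finite (characters A)"
  shows "unitary_rep (wreath A n) (Omega_rep A n \<kappa>)"
proof (rule unitary_rep.intro, rule group_wreath, fact, rule unitary_rep_axioms.intro,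
    unfold Omega_rep_simps)
  let ?\<Omega> = "Omega A n \<kappa>"
  have fin: "finite ?\<Omega>" using assms(3) by (rule finite_Omega)
  note act = Omega_rep_act[OF assms(3)]
  show "vector_space fun_scale" by (rule vector_space_fun_scale)
  show "fun_vs.subspace (fun_space ?\<Omega>)" by (rule subspace_fun_space)
  show "\<exists>S. finite S \<and> S \<subseteq> fun_space ?\<Omega> \<and> fun_vs.span S = fun_space ?\<Omega>"
    by (rule fun_subspace_finite_dim[OF fin subspace_fun_space order_refl])
  fix u v w :: "(nat \<Rightarrow> 'a \<Rightarrow> complex) \<Rightarrow> complex" and c :: complex
  show "(\<Sum>z\<in>?\<Omega>. (u + v) z * cnj (w z)) =
      (\<Sum>z\<in>?\<Omega>. u z * cnj (w z)) + (\<Sum>z\<in>?\<Omega>. v z * cnj (w z))"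
    by (simp add: sum.distrib algebra_simps)
  show "(\<Sum>z\<in>?\<Omega>. fun_scale c u z * cnj (v z)) = c * (\<Sum>z\<in>?\<Omega>. u z * cnj (v z))"
    by (simp add: fun_scale_def sum_distrib_left algebra_simps)
  show "(\<Sum>z\<in>?\<Omega>. v z * cnj (u z)) = cnj (\<Sum>z\<in>?\<Omega>. u z * cnj (v z))"
    by (simp add: cnj_sum mult.commute)
  show "0 < Re (\<Sum>z\<in>?\<Omega>. u z * cnj (u z))" if u: "u \<in> fun_space ?\<Omega>" "u \<noteq> 0"
  proof -
    obtain z where z: "z \<in> ?\<Omega>" "u z \<noteq> 0"
      using u by (auto simp: fun_space_def fun_eq_iff)
    have "Re (\<Sum>z\<in>?\<Omega>. u z * cnj (u z)) = (\<Sum>z\<in>?\<Omega>. (norm (u z))\<^sup>2)"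
      by (simp only: Re_sum complex_norm_square[symmetric] Re_complex_of_real)
    also have "\<dots> > 0"
      using z fin by (intro sum_pos2[of _ z]) auto
    finally show ?thesis .
  qed
  show "rep_act (Omega_rep A n \<kappa>) \<one>\<^bsub>wreath A n\<^esub> u = u" if "u \<in> fun_space ?\<Omega>"
    using that
    by (auto simp: one_wreath act permutes_id fun_eq_iff pairing_one[OF assms(1)] Omega_PiE
        perm_act_id Omega_extensional fun_space_def)
  fix g assume g: "g \<in> carrier (wreath A n)"
  obtain x p where xp: "g = (x, p)" by (cases g)
  have x: "x \<in> {1..n} \<rightarrow>\<^sub>E carrier A" and p: "p permutes {1..n}"
    using g by (auto simp: xp carrier_wreath)
  note p' = permutes_inv[OF p]
  show "rep_act (Omega_rep A n \<kappa>) g u \<in> fun_space ?\<Omega>"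
    by (auto simp: xp act p fun_space_def)
  show "rep_act (Omega_rep A n \<kappa>) g (u + v) =
      rep_act (Omega_rep A n \<kappa>) g u + rep_act (Omega_rep A n \<kappa>) g v"
    by (auto simp: xp act p fun_eq_iff algebra_simps)
  show "rep_act (Omega_rep A n \<kappa>) g (fun_scale c u) = fun_scale c (rep_act (Omega_rep A n \<kappa>) g u)"
    by (auto simp: xp act p fun_eq_iff fun_scale_def)
  show "(\<Sum>z\<in>?\<Omega>. rep_act (Omega_rep A n \<kappa>) g u z * cnj (rep_act (Omega_rep A n \<kappa>) g v z)) =
      (\<Sum>z\<in>?\<Omega>. u z * cnj (v z))"
  proof -
    have "(\<Sum>z\<in>?\<Omega>. rep_act (Omega_rep A n \<kappa>) g u z * cnj (rep_act (Omega_rep A n \<kappa>) g v z)) =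
        (\<Sum>z\<in>?\<Omega>. u (perm_act n (inv' p) z) * cnj (v (perm_act n (inv' p) z)))"
    proof (intro sum.cong refl)
      fix z assume z: "z \<in> ?\<Omega>"
      \<comment> \<open>The diagonal phases have norm 1 and cancel in the inner product, leaving a
        permutation of the summands.\<close>
      have "pairing n z x * cnj (pairing n z x) = 1"
        using norm_pairing[OF assms(1,2) Omega_PiE[OF z] x]
        by (simp add: complex_norm_square[symmetric])
      then show "rep_act (Omega_rep A n \<kappa>) g u z * cnj (rep_act (Omega_rep A n \<kappa>) g v z) =
          u (perm_act n (inv' p) z) * cnj (v (perm_act n (inv' p) z))"
        using z by (simp add: xp act p algebra_simps)
    qed
    also have "\<dots> = (\<Sum>z\<in>?\<Omega>. u z * cnj (v z))"
      by (rule sum.reindex_bij_betw[OF bij_betw_perm_act_Omega[OF p']])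
    finally show ?thesis .
  qed
  fix h assume h: "h \<in> carrier (wreath A n)"
  obtain y q where yq: "h = (y, q)" by (cases h)
  have y: "y \<in> {1..n} \<rightarrow>\<^sub>E carrier A" and q: "q permutes {1..n}"
    using h by (auto simp: yq carrier_wreath)
  have inv: "inv' (p \<circ> q) = inv' q \<circ> inv' p"
    by (rule o_inv_distrib[OF permutes_bij[OF p] permutes_bij[OF q]])
  \<comment> \<open>The product has tuple x (p . y), and its pairing with z factors as <z, x> <p^-1
    . z, y>; the second factor is the one produced by \<open>h\<close> at the point where
    \<open>g\<close> evaluates.\<close>
  show "rep_act (Omega_rep A n \<kappa>) (g \<otimes>\<^bsub>wreath A n\<^esub> h) u =
      rep_act (Omega_rep A n \<kappa>) g (rep_act (Omega_rep A n \<kappa>) h u)"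
    by (rule ext)
      (simp add: xp yq mult_wreath act p q permutes_compose inv Omega_PiE perm_act_Omega p'
        pairing_mult[OF _ x perm_act_PiE[OF p y]] pairing_perm_act[OF p]
        perm_act_comp[OF permutes_inv[OF q] p'])
qed

lemma fixed_space_Omega_rep:
  assumes "group A" "finite (characters A)"
    and nontriv: "nontrivial_rep (wreath A n) (Omega_rep A n \<kappa>)"
  shows "fixed_space (wreath A n) (Omega_rep A n \<kappa>) \<subseteq> {0}"
proof (rule subsetI, rule ccontr)
  let ?\<Omega> = "Omega A n \<kappa>"
  note act = Omega_rep_act[OF assms(2)]
  fix f assume "f \<in> fixed_space (wreath A n) (Omega_rep A n \<kappa>)" and "f \<notin> {0}"
  then have f: "f \<in> fun_space ?\<Omega>" "f \<noteq> 0"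
    and fix_f: "\<And>g. g \<in> carrier (wreath A n) \<Longrightarrow> rep_act (Omega_rep A n \<kappa>) g f = f"
    by (auto simp: fixed_space_def Omega_rep_simps)
  obtain z where z: "z \<in> ?\<Omega>" "f z \<noteq> 0"
    using f by (auto simp: fun_space_def fun_eq_iff)
  interpret A: group A by fact
  have one: "(\<lambda>i\<in>{1..n}. \<one>\<^bsub>A\<^esub>) \<in> {1..n} \<rightarrow>\<^sub>E carrier A" by auto
  \<comment> \<open>A permutation with the identity tuple acts without a phase, so invariance
    compares the values at \<open>u\<close> and \<open>z\<close>.\<close>
  have const: "f u = f z" if u: "u \<in> ?\<Omega>" for u
  proof -
    obtain p where p: "p permutes {1..n}" "perm_act n (inv' p) u = z"
      using Omega_transitive[OF z(1) u] .
    have "rep_act (Omega_rep A n \<kappa>) (\<lambda>i\<in>{1..n}. \<one>\<^bsub>A\<^esub>, p) f u = f u"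
      using fix_f[of "(\<lambda>i\<in>{1..n}. \<one>\<^bsub>A\<^esub>, p)"] one p by (auto simp: carrier_wreath)
    then show ?thesis
      using u p by (simp add: act pairing_one[OF assms(1)] Omega_PiE)
  qed
  \<comment> \<open>Tuples act diagonally, so invariance forces the phase to be 1 wherever
    \<open>f\<close> is non-zero; by \<open>const\<close> that is all of
    \<open>?\<Omega>\<close>.\<close>
  have pair: "pairing n u x = 1" if u: "u \<in> ?\<Omega>" and x: "x \<in> {1..n} \<rightarrow>\<^sub>E carrier A" for u x
  proof -
    have "rep_act (Omega_rep A n \<kappa>) (x, id) f u = f u"
      using fix_f[of "(x, id)"] x by (auto simp: carrier_wreath permutes_id)
    then show ?thesis
      using const[OF u] z(2) u by (simp add: act permutes_id perm_act_id Omega_extensional)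
  qed
  \<comment> \<open>The tuple with \<open>x\<close> in coordinate \<open>i\<close> and the identity
    elsewhere isolates this factor of the pairing.\<close>
  have triv: "u i x = 1" if u: "u \<in> ?\<Omega>" and i: "i \<in> {1..n}" and x: "x \<in> carrier A" for u i x
  proof -
    have "pairing n u (\<lambda>j\<in>{1..n}. if j = i then x else \<one>\<^bsub>A\<^esub>) = (\<Prod>j\<in>{1..n}. if j = i then u i x else 1)"
      unfolding pairing_def
      using Omega_PiE[OF u] by (intro prod.cong) (auto simp: PiE_iff character_one[OF assms(1)])
    also have "\<dots> = u i x" using i by simp
    finally show ?thesis using pair[OF u] x by auto
  qed
  \<comment> \<open>All entries are 1 on the carrier, and extensionality makes them equal as
    functions. Hence there is a single configuration, which every permutation fixes.\<close>
  have eq: "u = v" if u: "u \<in> ?\<Omega>" and v: "v \<in> ?\<Omega>" for u v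
  proof (rule PiE_ext[OF Omega_PiE[OF u] Omega_PiE[OF v]])
    fix i assume i: "i \<in> {1..n}"
    have "u i \<in> extensional (carrier A)" "v i \<in> extensional (carrier A)"
      using Omega_PiE[OF u] Omega_PiE[OF v] i by (auto simp: PiE_iff characters_def)
    then show "u i = v i"
      by (rule extensionalityI) (simp add: triv[OF u i] triv[OF v i])
  qed
  have "rep_act (Omega_rep A n \<kappa>) g v = v"
    if g: "g \<in> carrier (wreath A n)" and v: "v \<in> fun_space ?\<Omega>" for g v
  proof -
    obtain x p where xp: "g = (x, p)" by (cases g)
    have x: "x \<in> {1..n} \<rightarrow>\<^sub>E carrier A" and p: "p permutes {1..n}"
      using g by (auto simp: xp carrier_wreath)
    have "perm_act n (inv' p) u = u" if "u \<in> ?\<Omega>" for u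
      using that by (intro eq perm_act_Omega permutes_inv p)
    then show ?thesis
      using v by (intro ext) (simp add: xp act p pair x fun_space_def)
  qed
  then show False using nontriv by (auto simp: nontrivial_rep_def Omega_rep_simps)
qed

section \<open>The induced representation\<close>

locale block_config = comm_group A for A :: "('a, 'm) monoid_scheme" (structure) +
  fixes n :: nat and \<kappa> :: "('a \<Rightarrow> complex) \<Rightarrow> nat" and B :: "('a \<Rightarrow> complex) \<Rightarrow> nat set"
  assumes finite_carrier: "finite (carrier A)"
    and n_pos: "0 < n"
    and multiplicity: "multiplicity_vector A n \<kappa>"
    and blocks: "block_system A n \<kappa> B"
begin

abbreviation "W \<equiv> wreath A n"
abbreviation "\<Omega> \<equiv> Omega A n \<kappa>"
abbreviation "H \<equiv> block_subgroup A n B"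
abbreviation "V \<equiv> V_kappa A n B"

text \<open>A sum over an infinite set would be \<open>0\<close>, so the multiplicity condition forces finiteness.\<close>

lemma finite_characters: "finite (characters A)"
  using multiplicity n_pos by (auto simp: multiplicity_vector_def intro: ccontr)

text \<open>The description is unique on \<open>{1..n}\<close> because the blocks are disjoint and
  cover it; the restriction makes \<open>base\<close> extensional, as membership of
  \<open>\<Omega>\<close> demands.\<close>

definition base :: "nat \<Rightarrow> 'a \<Rightarrow> complex"
  where "base = (\<lambda>i\<in>{1..n}. THE \<chi>. \<chi> \<in> characters A \<and> i \<in> B \<chi>)"

lemma block_subset: "\<chi> \<in> characters A \<Longrightarrow> B \<chi> \<subseteq> {1..n}"
  using blocks by (auto simp: block_system_def)

lemma base_eq:
  assumes "\<chi> \<in> characters A" "i \<in> B \<chi>"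
  shows "base i = \<chi>"
proof -
  have "(THE \<eta>. \<eta> \<in> characters A \<and> i \<in> B \<eta>) = \<chi>"
    using assms blocks by (intro the_equality) (auto simp: block_system_def)
  then show ?thesis using block_subset[OF assms(1)] assms(2) by (auto simp: base_def)
qed

lemma block_cover:
  assumes "i \<in> {1..n}"
  obtains \<chi> where "\<chi> \<in> characters A" "i \<in> B \<chi>"
proof -
  have "i \<in> (\<Union>\<chi>\<in>characters A. B \<chi>)"
    using blocks assms unfolding block_system_def by blast
  then show thesis using that by blast
qed

lemma base_PiE: "base \<in> {1..n} \<rightarrow>\<^sub>E characters A"
proof (rule PiE_I)
  fix i assume "i \<in> {1..n}"
  then obtain \<chi> where "\<chi> \<in> characters A" "i \<in> B \<chi>"
    by (rule block_cover)
  then show "base i \<in> characters A" by (simp add: base_eq)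
qed (auto simp: base_def)

lemma base_fibre:
  assumes "\<chi> \<in> characters A"
  shows "{i \<in> {1..n}. base i = \<chi>} = B \<chi>"
proof (intro equalityI subsetI)
  fix i assume "i \<in> {i \<in> {1..n}. base i = \<chi>}"
  moreover from this obtain \<eta> where "\<eta> \<in> characters A" "i \<in> B \<eta>"
    using block_cover by blast
  ultimately show "i \<in> B \<chi>" by (auto simp: base_eq)
qed (use block_subset[OF assms] base_eq[OF assms] in auto)

lemma base_Omega: "base \<in> \<Omega>"
  using blocks base_PiE base_fibre unfolding Omega_def block_system_def
  by (simp del: atLeastAtMost_iff)

text \<open>The blocks partition \<open>{1..n}\<close>, so the double product meets each coordinate
  once. The scalar in \<open>block_rep\<close> thereby becomes a pairing, to which the rules for
  \<open>pairing\<close> apply.\<close>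

lemma base_pairing: "(\<Prod>\<chi>\<in>characters A. \<Prod>i\<in>B \<chi>. \<chi> (x i)) = pairing n base x"
proof -
  have "(\<Prod>\<chi>\<in>characters A. \<Prod>i\<in>B \<chi>. \<chi> (x i)) = (\<Prod>\<chi>\<in>characters A. \<Prod>i\<in>B \<chi>. base i (x i))"
    by (intro prod.cong) (auto simp: base_eq)
  also have "\<dots> = (\<Prod>i\<in>(\<Union>\<chi>\<in>characters A. B \<chi>). base i (x i))"
    using blocks finite_characters block_subset
    by (intro prod.UNION_disjoint[symmetric])
      (auto simp: block_system_def intro: finite_subset[OF block_subset])
  also have "(\<Union>\<chi>\<in>characters A. B \<chi>) = {1..n}"
    using blocks by (simp add: block_system_def)
  finally show ?thesis by (simp add: pairing_def)
qed

text \<open>The blocks are the fibres of \<open>base\<close>. A permutation preserving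
  \<open>base\<close> maps each fibre into itself, and injectivity together with finiteness makes
  the image the whole fibre.\<close>

lemma base_stabilizer:
  assumes s: "s permutes {1..n}"
  shows "(\<forall>\<chi>\<in>characters A. s ` B \<chi> = B \<chi>) \<longleftrightarrow> (\<forall>i\<in>{1..n}. base (s i) = base i)"
proof (intro iffI ballI)
  fix i assume *: "\<forall>\<chi>\<in>characters A. s ` B \<chi> = B \<chi>" and i: "i \<in> {1..n}"
  have "base i \<in> characters A" using base_PiE i by auto
  then have "s i \<in> B (base i)" using * base_fibre i by blast
  then show "base (s i) = base i" using base_eq \<open>base i \<in> characters A\<close> by simp
next
  fix \<chi> assume *: "\<forall>i\<in>{1..n}. base (s i) = base i" and \<chi>: "\<chi> \<in> characters A"
  have "s ` B \<chi> \<subseteq> B \<chi>"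
    using * permutes_in_image[OF s] by (auto simp: base_fibre[OF \<chi>, symmetric])
  then show "s ` B \<chi> = B \<chi>"
    by (intro card_subset_eq finite_subset[OF block_subset[OF \<chi>]])
      (auto simp: card_image inj_on_subset[OF permutes_inj[OF s]])
qed

lemma mem_block_subgroup:
  "(x, s) \<in> H \<longleftrightarrow> x \<in> {1..n} \<rightarrow>\<^sub>E carrier A \<and> s permutes {1..n} \<and> (\<forall>i\<in>{1..n}. base (s i) = base i)"
  using base_stabilizer[of s] by (auto simp: block_subgroup_def carrier_wreath)

section \<open>The equivariant functions as a unitary representation\<close>

lemma mult_mem: "\<lbrakk>g \<in> carrier W; h \<in> carrier W\<rbrakk> \<Longrightarrow> g \<otimes>\<^bsub>W\<^esub> h \<in> carrier W"
  by (rule monoid.m_closed[OF group.is_monoid[OF group_wreath[OF is_group]]])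

lemma V_space:
  "F \<in> rep_space V \<longleftrightarrow> (\<forall>g. g \<notin> carrier W \<longrightarrow> F g = 0) \<and>
    (\<forall>x s g. (x, s) \<in> H \<longrightarrow> g \<in> carrier W \<longrightarrow> F ((x, s) \<otimes>\<^bsub>W\<^esub> g) = pairing n base x * F g)"
  by (auto simp: V_kappa_def induced_rep_def block_rep_def base_pairing)

lemma V_scale: "rep_scale V = fun_scale"
  by (simp add: V_kappa_def induced_rep_def block_rep_def fun_scale_def fun_eq_iff)

lemma V_inner: "rep_inner V F F' = (\<Sum>g\<in>carrier W. F g * cnj (F' g)) / of_nat (card H)"
  by (simp add: V_kappa_def induced_rep_def block_rep_def)

lemma V_act: "rep_act V g F h = (if h \<in> carrier W then F (h \<otimes>\<^bsub>W\<^esub> g) else 0)"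
  by (simp add: V_kappa_def induced_rep_def)

text \<open>The inner product of \<open>V\<close> is divided by this cardinality, so its positivity
  is part of positive definiteness.\<close>

lemma card_block_subgroup_pos: "card H > 0"
proof -
  have "H \<subseteq> carrier W" by (auto simp: block_subgroup_def)
  then have "finite H" using finite_carrier_wreath[OF finite_carrier] finite_subset by blast
  moreover have "(\<lambda>i\<in>{1..n}. \<one>, id) \<in> H" by (auto simp: mem_block_subgroup permutes_id)
  ultimately show ?thesis by (auto simp: card_gt_0_iff)
qed

lemma V_subspace: "fun_vs.subspace (rep_space V)"
  unfolding fun_vs.subspace_def by (auto simp: V_space fun_scale_def algebra_simps)

text \<open>Right translation commutes with the left equivariance condition by associativity, and it
  permutes the group, so the sum defining the inner product is unchanged.\<close>

lemma unitary_rep_V: "unitary_rep W V"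
proof (rule unitary_rep.intro, rule group_wreath, rule is_group, rule unitary_rep_axioms.intro,
    unfold V_scale V_inner)
  interpret W: group W by (rule group_wreath[OF is_group])
  have fin: "finite (carrier W)" by (rule finite_carrier_wreath[OF finite_carrier])
  have HW: "h \<in> carrier W" if "h \<in> H" for h
    using that by (auto simp: block_subgroup_def)
  show "vector_space fun_scale" by (rule vector_space_fun_scale)
  show "fun_vs.subspace (rep_space V)" by (rule V_subspace)
  show "\<exists>S. finite S \<and> S \<subseteq> rep_space V \<and> fun_vs.span S = rep_space V"
    by (rule fun_subspace_finite_dim[OF fin V_subspace]) (auto simp: V_space fun_space_def)
  fix u v w :: "(nat \<Rightarrow> 'a) \<times> (nat \<Rightarrow> nat) \<Rightarrow> complex" and c :: complex
  show "(\<Sum>g\<in>carrier W. (u + v) g * cnj (w g)) / of_nat (card H) =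
      (\<Sum>g\<in>carrier W. u g * cnj (w g)) / of_nat (card H) +
      (\<Sum>g\<in>carrier W. v g * cnj (w g)) / of_nat (card H)"
    by (simp add: sum.distrib algebra_simps add_divide_distrib)
  show "(\<Sum>g\<in>carrier W. fun_scale c u g * cnj (v g)) / of_nat (card H) =
      c * ((\<Sum>g\<in>carrier W. u g * cnj (v g)) / of_nat (card H))"
    by (simp add: fun_scale_def sum_distrib_left algebra_simps)
  show "(\<Sum>g\<in>carrier W. v g * cnj (u g)) / of_nat (card H) =
      cnj ((\<Sum>g\<in>carrier W. u g * cnj (v g)) / of_nat (card H))"
    by (simp add: cnj_sum mult.commute)
  show "0 < Re ((\<Sum>g\<in>carrier W. u g * cnj (u g)) / of_nat (card H))"
    if u: "u \<in> rep_space V" "u \<noteq> 0"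
  proof -
    obtain g where g: "g \<in> carrier W" "u g \<noteq> 0"
      using u by (auto simp: V_space fun_eq_iff simp del: split_paired_All split_paired_Ex)
    have "Re (\<Sum>g\<in>carrier W. u g * cnj (u g)) = (\<Sum>g\<in>carrier W. (norm (u g))\<^sup>2)"
      by (simp only: Re_sum complex_norm_square[symmetric] Re_complex_of_real)
    also have "\<dots> > 0"
      using g fin by (intro sum_pos2[of _ g]) auto
    finally show ?thesis using card_block_subgroup_pos by (simp add: Re_divide_of_nat)
  qed
  show "rep_act V \<one>\<^bsub>W\<^esub> u = u" if "u \<in> rep_space V"
    using that by (auto simp: V_act fun_eq_iff V_space simp del: split_paired_All split_paired_Ex)
  fix g assume g: "g \<in> carrier W"
  show "rep_act V g u \<in> rep_space V" if u: "u \<in> rep_space V"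
    unfolding V_space
  proof (intro conjI allI impI)
    fix x s h assume h: "(x, s) \<in> H" "h \<in> carrier W"
    then have "u ((x, s) \<otimes>\<^bsub>W\<^esub> (h \<otimes>\<^bsub>W\<^esub> g)) = pairing n base x * u (h \<otimes>\<^bsub>W\<^esub> g)"
      using u g mult_mem unfolding V_space by blast
    then show "rep_act V g u ((x, s) \<otimes>\<^bsub>W\<^esub> h) = pairing n base x * rep_act V g u h"
      using h HW g by (simp add: V_act W.m_assoc)
  qed (simp add: V_act)
  show "rep_act V g (u + v) = rep_act V g u + rep_act V g v"
    by (auto simp: V_act fun_eq_iff)
  show "rep_act V g (fun_scale c u) = fun_scale c (rep_act V g u)"
    by (auto simp: V_act fun_eq_iff fun_scale_def)
  show "(\<Sum>h\<in>carrier W. rep_act V g u h * cnj (rep_act V g v h)) / of_nat (card H) =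
      (\<Sum>h\<in>carrier W. u h * cnj (v h)) / of_nat (card H)"
  proof -
    have "bij_betw (\<lambda>h. h \<otimes>\<^bsub>W\<^esub> g) (carrier W) (carrier W)"
      using g by (intro bij_betwI[where g = "\<lambda>h. h \<otimes>\<^bsub>W\<^esub> inv\<^bsub>W\<^esub> g"]) (auto simp: W.m_assoc)
    from sum.reindex_bij_betw[OF this, of "\<lambda>h. u h * cnj (v h)"]
    show ?thesis by (simp add: V_act)
  qed
  fix h assume "h \<in> carrier W"
  then show "rep_act V (g \<otimes>\<^bsub>W\<^esub> h) u = rep_act V g (rep_act V h u)"
    using g by (auto simp: V_act fun_eq_iff W.m_assoc)
qed

section \<open>Equivariant functions and functions of configurations\<close>

definition transport :: "(nat \<Rightarrow> 'a \<Rightarrow> complex) \<Rightarrow> nat \<Rightarrow> nat"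
  where "transport z = (SOME p. p permutes {1..n} \<and> perm_act n (inv' p) base = z)"

lemma transport:
  assumes "z \<in> \<Omega>"
  shows "transport z permutes {1..n}" "perm_act n (inv' (transport z)) base = z"
proof -
  have "\<exists>p. p permutes {1..n} \<and> perm_act n (inv' p) base = z"
    using Omega_transitive[OF assms base_Omega] by blast
  then have "transport z permutes {1..n} \<and> perm_act n (inv' (transport z)) base = z"
    unfolding transport_def by (rule someI_ex)
  then show "transport z permutes {1..n}" "perm_act n (inv' (transport z)) base = z" by auto
qed

text \<open>
  The cosets of \<open>H\<close> correspond to the configurations through \<open>(x, p) \<mapsto> p\<^sup>-\<^sup>1 \<cdot> base\<close>, because \<open>H\<close> acts
  from the left in \<open>induced_rep\<close>.
\<close>

definition config_fun ::
    "((nat \<Rightarrow> 'a) \<times> (nat \<Rightarrow> nat) \<Rightarrow> complex) \<Rightarrow> (nat \<Rightarrow> 'a \<Rightarrow> complex) \<Rightarrow> complex"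
  where "config_fun F z = (if z \<in> \<Omega> then F (\<lambda>i\<in>{1..n}. \<one>, transport z) else 0)"

text \<open>If \<open>q\<close> is the chosen representative with the same configuration as
  \<open>p\<close>, then p q^-1 stabilises \<open>base\<close>, and equivariance applies to (x, p) =
  (x, p q^-1) (1, q). In particular the choice made by \<open>transport\<close> does not affect
  \<open>config_fun F\<close>.\<close>

lemma V_eq_config_fun:
  assumes F: "F \<in> rep_space V" and x: "x \<in> {1..n} \<rightarrow>\<^sub>E carrier A" and p: "p permutes {1..n}"
  shows "F (x, p) = pairing n base x * config_fun F (perm_act n (inv' p) base)"
proof -
  let ?z = "perm_act n (inv' p) base"
  define q where "q = transport ?z"
  have z: "?z \<in> \<Omega>" by (intro perm_act_Omega permutes_inv p base_Omega)
  have q: "q permutes {1..n}" and qz: "perm_act n (inv' q) base = ?z"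
    using transport[OF z] by (auto simp: q_def)
  have base_q: "base (q i) = base (p i)" if "i \<in> {1..n}" for i
    using fun_cong[OF qz, of i] that
    by (simp add: perm_act_apply permutes_inv_inv[OF p] permutes_inv_inv[OF q])
  have "(x, p \<circ> inv' q) \<in> H"
    unfolding mem_block_subgroup
  proof (intro conjI ballI)
    fix i assume "i \<in> {1..n}"
    then have "inv' q i \<in> {1..n}"
      using permutes_in_image[OF permutes_inv[OF q]] by blast
    then show "base ((p \<circ> inv' q) i) = base i"
      using base_q[of "inv' q i"] by (simp add: permutes_inverses[OF q])
  qed (use x in \<open>auto intro: permutes_compose permutes_inv p q\<close>)
  moreover have "(\<lambda>i\<in>{1..n}. \<one>, q) \<in> carrier W"
    using q by (auto simp: carrier_wreath)
  ultimately have "F ((x, p \<circ> inv' q) \<otimes>\<^bsub>W\<^esub> (\<lambda>i\<in>{1..n}. \<one>, q)) =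
      pairing n base x * F (\<lambda>i\<in>{1..n}. \<one>, q)"
    using F unfolding V_space by blast
  moreover have "(x, p \<circ> inv' q) \<otimes>\<^bsub>W\<^esub> (\<lambda>i\<in>{1..n}. \<one>, q) = (x, p)"
  proof -
    have "(\<lambda>i\<in>{1..n}. x i \<otimes> perm_act n (p \<circ> inv' q) (\<lambda>i\<in>{1..n}. \<one>) i) = x"
    proof
      fix i
      have "perm_act n (p \<circ> inv' q) (\<lambda>i\<in>{1..n}. \<one>) \<in> {1..n} \<rightarrow>\<^sub>E {\<one>}"
        by (intro perm_act_PiE permutes_compose permutes_inv p q) auto
      then show "(\<lambda>i\<in>{1..n}. x i \<otimes> perm_act n (p \<circ> inv' q) (\<lambda>i\<in>{1..n}. \<one>) i) i = x i"
        using x by (auto simp: PiE_iff extensional_def)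
    qed
    moreover have "p \<circ> inv' q \<circ> q = p"
      using permutes_inv_o(2)[OF q] by (simp add: o_assoc[symmetric])
    ultimately show ?thesis by (simp add: mult_wreath)
  qed
  ultimately show ?thesis using z by (simp add: config_fun_def q_def)
qed

text \<open>The formula of \<open>V_eq_config_fun\<close> with an arbitrary \<open>f\<close> in
  place of \<open>config_fun F\<close>, which makes it the inverse of
  \<open>config_fun\<close>.\<close>

definition group_fun ::
    "((nat \<Rightarrow> 'a \<Rightarrow> complex) \<Rightarrow> complex) \<Rightarrow> (nat \<Rightarrow> 'a) \<times> (nat \<Rightarrow> nat) \<Rightarrow> complex"
  where "group_fun f = (\<lambda>(x, p). if (x, p) \<in> carrier W
    then pairing n base x * f (perm_act n (inv' p) base) else 0)"

lemma group_fun_mem: "group_fun f \<in> rep_space V"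
  unfolding V_space
proof (intro conjI allI impI)
  fix g assume "g \<notin> carrier W"
  then show "group_fun f g = 0" by (cases g) (simp add: group_fun_def)
next
  fix x s g assume "(x, s) \<in> H" and g: "g \<in> carrier W"
  then have x: "x \<in> {1..n} \<rightarrow>\<^sub>E carrier A" and s: "s permutes {1..n}"
    and stab: "\<And>i. i \<in> {1..n} \<Longrightarrow> base (s i) = base i"
    by (auto simp: mem_block_subgroup)
  obtain y p where yp: "g = (y, p)" by (cases g)
  have y: "y \<in> {1..n} \<rightarrow>\<^sub>E carrier A" and p: "p permutes {1..n}"
    using g by (auto simp: yp carrier_wreath)
  have "(x, s) \<in> carrier W" using x s by (simp add: carrier_wreath)
  from mult_mem[OF this g]
  have mem: "(\<lambda>i\<in>{1..n}. x i \<otimes> perm_act n s y i, s \<circ> p) \<in> carrier W"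
    by (simp add: yp mult_wreath)
  \<comment> \<open>With this, \<open>s\<close> disappears both from the configuration of
    \<open>s \<circ> p\<close> and from the pairing of \<open>base\<close> with
    \<open>perm_act n s y\<close>.\<close>
  have s_base: "perm_act n (inv' s) base = base"
    using stab Omega_extensional[OF base_Omega]
    by (auto simp: perm_act_def permutes_inv_inv[OF s] extensional_def fun_eq_iff)
  have "perm_act n (inv' (s \<circ> p)) base = perm_act n (inv' p) base"
    using perm_act_comp[OF permutes_inv[OF p] permutes_inv[OF s], of base]
    by (simp add: o_inv_distrib[OF permutes_bij[OF s] permutes_bij[OF p]] s_base)
  moreover have "pairing n base (\<lambda>i\<in>{1..n}. x i \<otimes> perm_act n s y i) =
      pairing n base x * pairing n base y"
    by (simp add: pairing_mult[OF base_PiE x perm_act_PiE[OF s y]] pairing_perm_act[OF s] s_base)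
  ultimately show "group_fun f ((x, s) \<otimes>\<^bsub>W\<^esub> g) = pairing n base x * group_fun f g"
    using g mem by (simp add: yp mult_wreath group_fun_def)
qed

lemma config_fun_group_fun:
  assumes "f \<in> fun_space \<Omega>"
  shows "config_fun (group_fun f) = f"
proof
  fix z
  show "config_fun (group_fun f) z = f z"
  proof (cases "z \<in> \<Omega>")
    case True
    have "(\<lambda>i\<in>{1..n}. \<one>, transport z) \<in> carrier W"
      using transport(1)[OF True] by (auto simp: carrier_wreath)
    then show ?thesis
      using True transport(2)[OF True]
      by (simp add: config_fun_def group_fun_def pairing_one[OF is_group base_PiE])
  qed (use assms in \<open>auto simp: config_fun_def fun_space_def\<close>)
qed

lemma group_fun_config_fun:
  assumes "F \<in> rep_space V"
  shows "group_fun (config_fun F) = F"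
proof
  fix g :: "(nat \<Rightarrow> 'a) \<times> (nat \<Rightarrow> nat)"
  obtain x p where g: "g = (x, p)" by (cases g)
  show "group_fun (config_fun F) g = F g"
  proof (cases "g \<in> carrier W")
    case True
    then show ?thesis
      using V_eq_config_fun[OF assms, of x p] by (simp add: g group_fun_def carrier_wreath)
  next
    case False
    then have "F g = 0" using assms unfolding V_space by blast
    then show ?thesis using False by (simp add: g group_fun_def)
  qed
qed

text \<open>For equivariance, let (1, p) represent \<open>z\<close>. Right translation by (x, q)
  evaluates at (1, p) (x, q) = (p . x, p q), whose configuration is q^-1 . z and whose phase <base,
  p . x> equals <z, x>; this is the action on functions of configurations.\<close>

lemma rep_iso_V_Omega_rep: "rep_iso W V (Omega_rep A n \<kappa>)"
  unfolding rep_iso_def Omega_rep_simps V_scale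
proof (intro exI[of _ config_fun] conjI ballI allI)
  show "bij_betw config_fun (rep_space V) (fun_space \<Omega>)"
    by (rule bij_betwI[where g = group_fun])
      (auto simp: group_fun_mem config_fun_group_fun group_fun_config_fun,
        auto simp: config_fun_def fun_space_def)
  show "config_fun (F + F') = config_fun F + config_fun F'" for F F'
    by (auto simp: config_fun_def fun_eq_iff)
  show "config_fun (fun_scale c F) = fun_scale c (config_fun F)" for c F
    by (auto simp: config_fun_def fun_eq_iff fun_scale_def)
  fix g F assume g: "g \<in> carrier W" and F: "F \<in> rep_space V"
  obtain x q where xq: "g = (x, q)" by (cases g)
  have x: "x \<in> {1..n} \<rightarrow>\<^sub>E carrier A" and q: "q permutes {1..n}"
    using g by (auto simp: xq carrier_wreath)
  show "config_fun (rep_act V g F) = rep_act (Omega_rep A n \<kappa>) g (config_fun F)"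
  proof
    fix z
    show "config_fun (rep_act V g F) z = rep_act (Omega_rep A n \<kappa>) g (config_fun F) z"
    proof (cases "z \<in> \<Omega>")
      case True
      define p where "p = transport z"
      have p: "p permutes {1..n}" and pz: "perm_act n (inv' p) base = z"
        using transport[OF True] by (auto simp: p_def)
      have mem: "(\<lambda>i\<in>{1..n}. \<one>, p) \<in> carrier W" using p by (auto simp: carrier_wreath)
      have px: "perm_act n p x \<in> {1..n} \<rightarrow>\<^sub>E carrier A" by (rule perm_act_PiE[OF p x])
      have "(\<lambda>i\<in>{1..n}. \<one>, p) \<otimes>\<^bsub>W\<^esub> g = (perm_act n p x, p \<circ> q)"
        using px by (auto simp: xq mult_wreath PiE_iff extensional_def fun_eq_iff)
      moreover have "perm_act n (inv' (p \<circ> q)) base = perm_act n (inv' q) z"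
        using perm_act_comp[OF permutes_inv[OF q] permutes_inv[OF p], of base]
        by (simp add: o_inv_distrib[OF permutes_bij[OF p] permutes_bij[OF q]] pz)
      moreover have "p \<circ> q permutes {1..n}" by (rule permutes_compose[OF q p])
      ultimately show ?thesis
        using True mem V_eq_config_fun[OF F px, of "p \<circ> q"]
        by (simp add: xq Omega_rep_act[OF finite_characters q] pairing_perm_act[OF p] pz
            config_fun_def[of "rep_act V _ _"] V_act p_def[symmetric])
    qed (simp add: config_fun_def xq Omega_rep_act[OF finite_characters q])
  qed
qed

end

section \<open>The Laplacian\<close>

text \<open>After the sums are interchanged, each point mass selects one group element. If
  \<open>h\<close> repeats a value, the weights add up on both sides.\<close>

lemma sum_galg_of:
  assumes "finite I" "finite C" "\<And>i. i \<in> I \<Longrightarrow> h i \<in> C"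
  shows "(\<Sum>g\<in>C. complex_of_real (\<Sum>i\<in>I. b i * galg_of (h i) g) * D g) =
    (\<Sum>i\<in>I. complex_of_real (b i) * D (h i))"
proof -
  have "(\<Sum>g\<in>C. complex_of_real (\<Sum>i\<in>I. b i * galg_of (h i) g) * D g) =
      (\<Sum>i\<in>I. \<Sum>g\<in>C. complex_of_real (b i * galg_of (h i) g) * D g)"
    by (subst sum.swap) (simp add: sum_distrib_right)
  also have "\<dots> = (\<Sum>i\<in>I. \<Sum>g\<in>C. if g = h i then complex_of_real (b i) * D (h i) else 0)"
    by (intro sum.cong) (auto simp: galg_of_def)
  also have "\<dots> = (\<Sum>i\<in>I. complex_of_real (b i) * D (h i))"
    using assms by (intro sum.cong) auto
  finally show ?thesis .
qed

text \<open>The substitution of x^-1 for \<open>x\<close> preserves the weights and conjugates the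
  pairing, so the sum equals its own conjugate and hence its real part.\<close>

lemma sum_pairing_real:
  assumes "group A" "finite (carrier A)" "z \<in> {1..n} \<rightarrow>\<^sub>E characters A"
    and c_inv: "\<And>x. x \<in> carrier (power_group A n) \<Longrightarrow> c x = c (inv\<^bsub>power_group A n\<^esub> x)"
  shows "(\<Sum>x\<in>carrier (power_group A n). complex_of_real (c x) * pairing n z x) =
    (\<Sum>x\<in>carrier (power_group A n). complex_of_real (c x * Re (pairing n z x)))"
    (is "?L = _")
proof -
  interpret P: group "power_group A n"
    unfolding power_group_def by (rule product_group) (rule assms(1))
  have "bij_betw (\<lambda>x. inv\<^bsub>power_group A n\<^esub> x) (carrier (power_group A n)) (carrier (power_group A n))"
    by (intro bij_betwI[where g = "\<lambda>x. inv\<^bsub>power_group A n\<^esub> x"] funcsetI P.inv_closed P.inv_inv)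
  from sum.reindex_bij_betw[OF this, of "\<lambda>x. complex_of_real (c x) * pairing n z x"]
  have "?L = (\<Sum>x\<in>carrier (power_group A n). complex_of_real (c x) * cnj (pairing n z x))"
    using c_inv by (simp add: pairing_inv[OF assms(1-3)] cong: sum.cong)
  also have "\<dots> = cnj ?L" by (simp add: cnj_sum)
  finally have "?L \<in> \<real>" by (simp add: Reals_cnj_iff)
  then have L: "?L = complex_of_real (Re ?L)" by (rule of_real_Re[symmetric])
  have "Re ?L = (\<Sum>x\<in>carrier (power_group A n). c x * Re (pairing n z x))"
    unfolding Re_sum by (intro sum.cong) auto
  then show ?thesis unfolding of_real_sum[symmetric] by (subst L) (rule arg_cong)
qed

lemma galg_act_Omega_rep:
  assumes "group A" "finite (carrier A)" "finite (characters A)"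
    and f: "f \<in> fun_space (Omega A n \<kappa>)"
    and c_inv: "\<And>x. x \<in> carrier (power_group A n) \<Longrightarrow> c x = c (inv\<^bsub>power_group A n\<^esub> x)"
  shows "galg_act (wreath A n) (Omega_rep A n \<kappa>)
      (galg_lap (wreath A n) (\<lambda>g. w_T A n a g + w_N A n c g)) f = L_kappa A n \<kappa> a c f"
proof
  interpret A: group A by fact
  interpret R: unitary_rep "wreath A n" "Omega_rep A n \<kappa>"
    by (rule unitary_rep_Omega_rep) fact+
  let ?W = "carrier (wreath A n)" and ?P = "carrier (power_group A n)"
  have finW: "finite ?W" by (rule finite_carrier_wreath) fact
  fix z
  let ?D = "\<lambda>g. f z - rep_act (Omega_rep A n \<kappa>) g f z"
  have lap: "galg_act (wreath A n) (Omega_rep A n \<kappa>)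
      (galg_lap (wreath A n) (\<lambda>g. w_T A n a g + w_N A n c g)) f z =
      (\<Sum>g\<in>?W. complex_of_real (w_T A n a g) * ?D g) +
      (\<Sum>g\<in>?W. complex_of_real (w_N A n c g) * ?D g)"
    using f by (simp add: R.galg_act_lap[OF finW] Omega_rep_simps sum_fun_apply fun_scale_def
        sum.distrib[symmetric] algebra_simps)
  show "galg_act (wreath A n) (Omega_rep A n \<kappa>)
      (galg_lap (wreath A n) (\<lambda>g. w_T A n a g + w_N A n c g)) f z = L_kappa A n \<kappa> a c f z"
  proof (cases "z \<in> Omega A n \<kappa>")
    case False
    \<comment> \<open>Outside the configurations \<open>f\<close> and all its translates vanish, in
      agreement with the default value 0 in \<open>L_kappa\<close>.\<close>
    then have "?D g = 0" if "g \<in> ?W" for g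
      using f that by (cases g) (auto simp: Omega_rep_act[OF assms(3)] carrier_wreath fun_space_def)
    then show ?thesis using False unfolding lap by (simp add: L_kappa_def)
  next
    case True
    \<comment> \<open>The double sum becomes a sum over one index set, the form required by
      \<open>sum_galg_of\<close>.\<close>
    let ?I = "SIGMA i:{1..n}. {i<..n}"
    have "(\<Sum>g\<in>?W. complex_of_real (w_T A n a g) * ?D g) =
        (\<Sum>g\<in>?W. complex_of_real (\<Sum>(i, j)\<in>?I. a i j *
          galg_of (wreath_perm A n (transpose i j)) g) * ?D g)"
      by (simp add: w_T_def sum.Sigma)
    also have "\<dots> = (\<Sum>(i, j)\<in>?I. complex_of_real (a i j) * ?D (wreath_perm A n (transpose i j)))"
      using sum_galg_of[of ?I ?W "\<lambda>(i, j). wreath_perm A n (transpose i j)" "\<lambda>(i, j). a i j" ?D] finW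
      by (force simp: split_def carrier_wreath wreath_perm_def power_group_def
          intro!: permutes_swap_id)
    also have "\<dots> = (\<Sum>i\<in>{1..n}. \<Sum>j\<in>{i<..n}. complex_of_real (a i j) *
        (f z - f (perm_act n (transpose i j) z)))"
    proof -
      \<comment> \<open>A transposition is its own inverse, so the inverse in
        \<open>Omega_rep_act\<close> disappears; its tuple is the identity and contributes the phase
        1.\<close>
      have "?D (wreath_perm A n (transpose i j)) = f z - f (perm_act n (transpose i j) z)"
        if "i \<in> {1..n}" "j \<in> {i<..n}" for i j
      proof -
        have "transpose i j permutes {1..n}" using that by (intro permutes_swap_id) auto
        then show ?thesis
          using True by (simp add: wreath_perm_def Omega_rep_act[OF assms(3)] power_group_def
              pairing_one[OF assms(1)] Omega_PiE)
      qed
      then show ?thesis by (simp add: sum.Sigma[symmetric])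
    qed
    finally have T: "(\<Sum>g\<in>?W. complex_of_real (w_T A n a g) * ?D g) =
        (\<Sum>i\<in>{1..n}. \<Sum>j\<in>{i<..n}. complex_of_real (a i j) *
          (f z - f (perm_act n (transpose i j) z)))" .
    have "finite ?P" using assms(2) by (simp add: finite_PiE)
    then have "(\<Sum>g\<in>?W. complex_of_real (w_N A n c g) * ?D g) =
        (\<Sum>x\<in>?P. complex_of_real (c x) * ?D (wreath_base n x))"
      unfolding w_N_def
      by (intro sum_galg_of finW) (auto simp: wreath_base_def carrier_wreath sym_group_def permutes_id)
    also have "\<dots> = (\<Sum>x\<in>?P. complex_of_real (c x) * (f z - pairing n z x * f z))"
      using True by (simp add: wreath_base_def sym_group_def Omega_rep_act[OF assms(3)]
          permutes_id perm_act_id Omega_extensional)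
    also have "\<dots> = ((\<Sum>x\<in>?P. complex_of_real (c x)) -
        (\<Sum>x\<in>?P. complex_of_real (c x) * pairing n z x)) * f z"
      by (simp add: sum_subtractf sum_distrib_left sum_distrib_right algebra_simps)
    \<comment> \<open>The symmetry of \<open>c\<close> replaces each pairing by its real part under
      the sum.\<close>
    also have "\<dots> = complex_of_real (Q_pot A n c z) * f z"
      using sum_pairing_real[of A z n c, OF assms(1,2) Omega_PiE[OF True]] c_inv
      by (simp add: Q_pot_def sum_subtractf algebra_simps)
    finally have "(\<Sum>g\<in>?W. complex_of_real (w_N A n c g) * ?D g) =
        complex_of_real (Q_pot A n c z) * f z" .
    with T show ?thesis using True unfolding lap by (simp add: L_kappa_def)
  qed
qed

theorem proposition5p1:
  fixes A :: "('a, 'm) monoid_scheme"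
    and n :: nat
    and a :: "nat \<Rightarrow> nat \<Rightarrow> real"
    and c :: "(nat \<Rightarrow> 'a) \<Rightarrow> real"
    and \<kappa> :: "('a \<Rightarrow> complex) \<Rightarrow> nat"
    and B :: "('a \<Rightarrow> complex) \<Rightarrow> nat set"
  assumes "comm_group A" and "finite (carrier A)"
    and "n \<ge> 2"
    and "\<And>i j. \<lbrakk>1 \<le> i; i < j; j \<le> n\<rbrakk> \<Longrightarrow> a i j \<ge> 0"
    and "\<And>x. x \<in> carrier (power_group A n) \<Longrightarrow> c x \<ge> 0"
    and "\<And>x. x \<in> carrier (power_group A n) \<Longrightarrow> c x = c (inv\<^bsub>power_group A n\<^esub> x)"
    and "multiplicity_vector A n \<kappa>"
    and "block_system A n \<kappa> B"
  shows "unitary_rep (wreath A n) (V_kappa A n B) \<and>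
    unitary_rep (wreath A n) (Omega_rep A n \<kappa>) \<and>
    rep_iso (wreath A n) (V_kappa A n B) (Omega_rep A n \<kappa>) \<and>
    (\<forall>f\<in>rep_space (Omega_rep A n \<kappa>).
      galg_act (wreath A n) (Omega_rep A n \<kappa>)
        (galg_lap (wreath A n) (\<lambda>g. w_T A n a g + w_N A n c g)) f = L_kappa A n \<kappa> a c f) \<and>
    (nontrivial_rep (wreath A n) (V_kappa A n B) \<longrightarrow>
      psi (wreath A n) (\<lambda>g. w_T A n a g + w_N A n c g) (V_kappa A n B) =
        ereal (least_eigenvalue fun_scale (fun_space (Omega A n \<kappa>)) (L_kappa A n \<kappa> a c)))"
proof -
  \<comment> \<open>The bound on \<open>n\<close> enters as \<open>0 < n\<close>, from which
    \<open>finite_characters\<close> is derived.\<close>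
  interpret block_config A n \<kappa> B
    using assms unfolding block_config_def block_config_axioms_def by simp
  have Omega: "unitary_rep W (Omega_rep A n \<kappa>)"
    by (rule unitary_rep_Omega_rep[OF is_group finite_carrier finite_characters])
  have act: "galg_act W (Omega_rep A n \<kappa>) (galg_lap W (\<lambda>g. w_T A n a g + w_N A n c g)) f =
      L_kappa A n \<kappa> a c f" if "f \<in> fun_space \<Omega>" for f
    by (rule galg_act_Omega_rep[where c = c, OF is_group finite_carrier finite_characters that assms(6)])
  have "psi W (\<lambda>g. w_T A n a g + w_N A n c g) V =
      ereal (least_eigenvalue fun_scale (fun_space \<Omega>) (L_kappa A n \<kappa> a c))"
    if "nontrivial_rep W V"
  proof -
    have "psi W (\<lambda>g. w_T A n a g + w_N A n c g) V =
        ereal (least_eigenvalue fun_scale (fun_space \<Omega>)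
          (galg_act W (Omega_rep A n \<kappa>) (galg_lap W (\<lambda>g. w_T A n a g + w_N A n c g))))"
      using psi_eq_of_rep_iso[OF unitary_rep_V Omega rep_iso_V_Omega_rep that
          fixed_space_Omega_rep[OF is_group finite_characters]]
      by (simp add: Omega_rep_simps)
    \<comment> \<open>The two operators are known to agree only on
      \<open>fun_space \<Omega>\<close>, which is where \<open>least_eigenvalue\<close> looks for
      eigenvectors.\<close>
    then show ?thesis
      by (simp add: least_eigenvalue_def act cong: bex_cong)
  qed
  then show ?thesis
    using unitary_rep_V Omega rep_iso_V_Omega_rep act by (simp add: Omega_rep_simps)
qed

end
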